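(* Let $w\in\mathcal S_n$. Setting $x_i:=y_{-i}$ for $i<0$, we have $$\mathcal H_w(x;y)=\sum_{D\in\mathcal D(w)}\ \prod_{(i,j)\in D}x_i\prod_{(i,j)\notin D\sqcup\mathrm{rabs}(D)}(1-x_i),$$ where the second product is over positions $(i,j)$ with $i\neq0$, $j\ge1$, $|i|+j\le n$. The same formula holds with $\mathrm{rabs}(D)$ replaced by $\mathrm{labs}(D)$.
   Context: $s_i$ is the transposition of $i,i+1$, products of permutations are compositions $(uv)(i)=u(v(i))$, $\ell$ is the number of inversions, $\omega_0=[n,n-1,\dots,1]\in\mathcal S_n$. Double $\mathcal H$-polynomials (for fixed $n$): $s_i$ acts on polynomials in $x_1,\dots,x_n,y_1,\dots,y_n$ by exchanging $x_i,x_{i+1}$. Let $\pi_i f=\dfrac{(1-x_{i+1})f-s_i((1-x_{i+1})f)}{x_i-x_{i+1}}$, $\mu_i=\pi_i-1$, and $\mu_v=\mu_{i_1}\cdots\mu_{i_r}$ for any reduced word $v=s_{i_1}\cdots s_{i_r}$. Then $\mathcal H_{\omega_0}(x;y)=\prod_{i+j\le n}(x_i+y_j-x_iy_j)$ and $\mathcal H_w(x;y)=\mu_{w^{-1}\omega_0}\mathcal H_{\omega_0}(x;y)$. Rc-graphs: a subset $R$ of $\{(i,j)\in\mathbb Z_{>0}^2\mid i+j\le n\}$ ($i$ the row, numbered top to bottom; $j$ the column, left to right), with positions ordered by $(i,j)\le(i',j')$ iff $i<i'$ or ($i=i'$ and $j\ge j'$), is an rc-graph for $u\in\mathcal S_n$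 if $(a_1,a_2,\dots)$ with $a_k=i_k+j_k-1$, $(i_k,j_k)$ the $k$-th element of $R$, is a reduced word for $u$. It is drawn with $n$ lines going up and to the right, the $i$-th from the left end of row $i$ to the top of column $u_i$; at positions of $R$ the two lines cross (one horizontal, one vertical), and at other positions they avoid each other (the line entering from the left turns up, the line entering from below turns right). Double rc-graphs: $\mathcal D(w)$ is the set of double rc-graphs for $w$: a pair of permutations $(u,v)$ with $v^{-1}u=w$ and $\ell(w)=\ell(u)+\ell(v)$, together with an rc-graph for $u$ and an rc-graph for $v$. The rc-graph for $v$ is drawn upside down above the rc-graph for $u$, its row $i$ being labeled $-i$; thus $D$ is a subset of $\{(i,j)\mid i\ne0,\ j\ge1,\ |i|+j\le n\}$ whose part with $i>0$ is the rc-graph for $u$ and whose part with $i<0$ is, after $(i,j)\mapsto(-i,j)$, the rc-graph for $v$. The lines are joined column by column: the $i$-th line starts at the left end of row $i$ of the lower part, goes up and right to the top of column $u_i$, enters the reflected diagram of $v$ from below in column $u_i$, and then goes up and left to the left end of row $-v^{-1}(u_i)$. A position $(i,j)\notin D$ with $i\ne 0$, $|i|+j\le n$, is right absorbable (respectively left absorbable) if the two lines avoiding each other there cross at another position that comes after (respectively before) this one when the lines are followed upward as just described. $\mathrm{rabs}(D)$ and $\mathrm{labs}(D)$ denote the sets of right and left absorbable positions. *)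

theory Defs
  imports "HOL-Library.Poly_Mapping" "HOL-Combinatorics.Permutations"
begin

section \<open>Permutations\<close>

definition simple_refl :: "nat \<Rightarrow> nat \<Rightarrow> nat" where
  "simple_refl i = transpose i (i + 1)"

text \<open>For a permutation of \<open>{1..n}\<close>, regarded as a function that is the identity elsewhere,
  all inversions lie in \<open>{1..n}\<close>, so this does not depend on \<open>n\<close>.\<close>
definition perm_length :: "(nat \<Rightarrow> nat) \<Rightarrow> nat" where
  "perm_length w = card {(i, j). i < j \<and> w j < w i}"

definition longest_perm :: "nat \<Rightarrow> nat \<Rightarrow> nat" where
  "longest_perm n i = (if i \<in> {1..n} then n + 1 - i else i)"

definition reduced_word :: "nat \<Rightarrow> (nat \<Rightarrow> nat) \<Rightarrow> nat list \<Rightarrow> bool" where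
  "reduced_word n v as \<longleftrightarrow>
     set as \<subseteq> {1..<n} \<and> foldr (\<lambda>a u. simple_refl a \<circ> u) as id = v \<and> length as = perm_length v"


section \<open>Double H-polynomials\<close>

text \<open>Integer polynomials in variables indexed by the integers; monomials are finitely supported
  exponent functions. The variable of index \<open>i > 0\<close> is \<open>x\<^sub>i\<close>, the one of index \<open>-j < 0\<close> is \<open>y\<^sub>j\<close>;
  this builds in the convention that \<open>x\<^sub>i\<close> means \<open>y\<close> with index \<open>-i\<close> for \<open>i < 0\<close>.\<close>
type_synonym xy_poly = "(int \<Rightarrow>\<^sub>0 nat) \<Rightarrow>\<^sub>0 int"

definition Var :: "int \<Rightarrow> xy_poly" where
  "Var i = Poly_Mapping.single (Poly_Mapping.single i 1) 1"

abbreviation X :: "nat \<Rightarrow> xy_poly" where "X i \<equiv> Var (int i)"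
abbreviation Y :: "nat \<Rightarrow> xy_poly" where "Y j \<equiv> Var (- int j)"

text \<open>\<open>swap_vars i\<close> exchanges \<open>X i\<close> and \<open>X (i + 1)\<close>: the coefficient of a monomial \<open>m\<close> in the
  result is the coefficient in \<open>f\<close> of \<open>m\<close> with these two exponents exchanged.\<close>
definition swap_vars :: "nat \<Rightarrow> xy_poly \<Rightarrow> xy_poly" where
  "swap_vars i f =
     Poly_Mapping.map_key (Poly_Mapping.map_key (transpose (int i) (int (i + 1)))) f"

text \<open>The exact quotient by \<open>X i - X (i + 1)\<close>. It exists since the numerator is antisymmetric
  in these two variables, and is unique since \<^typ>\<open>xy_poly\<close> is an integral domain.\<close>
definition pi_op :: "nat \<Rightarrow> xy_poly \<Rightarrow> xy_poly" where
  "pi_op i f = (THE g. (X i - X (i + 1)) * g =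
     (1 - X (i + 1)) * f - swap_vars i ((1 - X (i + 1)) * f))"

definition mu_op :: "nat \<Rightarrow> xy_poly \<Rightarrow> xy_poly" where
  "mu_op i f = pi_op i f - f"

text \<open>The \<open>mu_op i\<close> satisfy the braid relations, so the choice of the reduced word is immaterial.\<close>
definition mu_perm :: "nat \<Rightarrow> (nat \<Rightarrow> nat) \<Rightarrow> xy_poly \<Rightarrow> xy_poly" where
  "mu_perm n v f = foldr mu_op (SOME as. reduced_word n v as) f"

definition H_longest :: "nat \<Rightarrow> xy_poly" where
  "H_longest n = (\<Prod>(i, j)\<in>{(i, j). 1 \<le> i \<and> 1 \<le> j \<and> i + j \<le> n}. X i + Y j - X i * Y j)"

definition double_H :: "nat \<Rightarrow> (nat \<Rightarrow> nat) \<Rightarrow> xy_poly" where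
  "double_H n w = mu_perm n (inv w \<circ> longest_perm n) (H_longest n)"


section \<open>Rc-graphs and double rc-graphs\<close>

definition rc_le :: "nat \<times> nat \<Rightarrow> nat \<times> nat \<Rightarrow> bool" where
  "rc_le p q \<longleftrightarrow> fst p < fst q \<or> fst p = fst q \<and> snd p \<ge> snd q"

definition rc_graph :: "nat \<Rightarrow> (nat \<Rightarrow> nat) \<Rightarrow> (nat \<times> nat) set \<Rightarrow> bool" where
  "rc_graph n u R \<longleftrightarrow>
     R \<subseteq> {(i, j). 1 \<le> i \<and> 1 \<le> j \<and> i + j \<le> n} \<and>
     (\<exists>ps. set ps = R \<and> distinct ps \<and> sorted_wrt rc_le ps \<and>
           reduced_word n u (map (\<lambda>(i, j). i + j - 1) ps))"

definition positions :: "nat \<Rightarrow> (int \<times> nat) set" where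
  "positions n = {(i, j). i \<noteq> 0 \<and> 1 \<le> j \<and> \<bar>i\<bar> + int j \<le> int n}"

definition double_diagram :: "(nat \<times> nat) set \<Rightarrow> (nat \<times> nat) set \<Rightarrow> (int \<times> nat) set" where
  "double_diagram R S = (\<lambda>(i, j). (int i, j)) ` R \<union> (\<lambda>(i, j). (- int i, j)) ` S"

text \<open>The diagram determines \<open>R\<close> and \<open>S\<close>, hence also \<open>u\<close> and \<open>v\<close>, so a double rc-graph may be
  identified with its set of positions.\<close>
definition double_rc_graphs :: "nat \<Rightarrow> (nat \<Rightarrow> nat) \<Rightarrow> (int \<times> nat) set set" where
  "double_rc_graphs n w = {double_diagram R S | R S u v.
     u permutes {1..n} \<and> v permutes {1..n} \<and> inv v \<circ> u = w \<and>
     perm_length w = perm_length u + perm_length v \<and> rc_graph n u R \<and> rc_graph n v S}"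


section \<open>Lines of a double rc-graph\<close>

text \<open>\<open>((i, j), h)\<close> is a line arriving at position \<open>(i, j)\<close>: with \<open>h = Across\<close> it comes in
  through the left side if \<open>i > 0\<close>, through the right side if \<open>i < 0\<close>; with \<open>h = Upward\<close> it comes
  in from below. Lines go straight at positions of \<open>D\<close> and turn at all others, in particular at
  the boundary positions \<open>\<bar>i\<bar> + j = n + 1\<close>, which are never in \<open>D\<close>. Row \<open>-1\<close> lies directly above
  row \<open>1\<close>. A line that has reached column \<open>0\<close> has left the diagram and stays there.\<close>
datatype heading = Across | Upward

fun turn :: "heading \<Rightarrow> heading" where
  "turn Across = Upward"
| "turn Upward = Across"

fun advance :: "(int \<times> nat) \<times> heading \<Rightarrow> (int \<times> nat) \<times> heading" where
  "advance ((i, j), Across) = ((i, if i > 0 then j + 1 else j - 1), Across)"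
| "advance ((i, j), Upward) = ((if i = 1 then -1 else i - 1, j), Upward)"

definition line_step :: "(int \<times> nat) set \<Rightarrow> (int \<times> nat) \<times> heading \<Rightarrow> (int \<times> nat) \<times> heading" where
  "line_step D = (\<lambda>(p, h). if snd p = 0 then (p, h)
                           else advance (p, if p \<in> D then h else turn h))"

definition line_position :: "(int \<times> nat) set \<Rightarrow> nat \<Rightarrow> nat \<Rightarrow> int \<times> nat" where
  "line_position D k t = fst ((line_step D ^^ t) ((int k, 1), Across))"

definition precedes_on_line :: "(int \<times> nat) set \<Rightarrow> nat \<Rightarrow> int \<times> nat \<Rightarrow> int \<times> nat \<Rightarrow> bool" where
  "precedes_on_line D k p q \<longleftrightarrow>
     (\<exists>s t. s < t \<and> line_position D k s = p \<and> line_position D k t = q)"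

text \<open>Every position lies on exactly two lines, which cross there if the position is in \<open>D\<close> and
  avoid each other otherwise.\<close>
definition rabs :: "nat \<Rightarrow> (int \<times> nat) set \<Rightarrow> (int \<times> nat) set" where
  "rabs n D = {p \<in> positions n - D. \<exists>q\<in>D. \<exists>a\<in>{1..n}. \<exists>b\<in>{1..n}. a \<noteq> b \<and>
     precedes_on_line D a p q \<and> precedes_on_line D b p q}"

definition labs :: "nat \<Rightarrow> (int \<times> nat) set \<Rightarrow> (int \<times> nat) set" where
  "labs n D = {p \<in> positions n - D. \<exists>q\<in>D. \<exists>a\<in>{1..n}. \<exists>b\<in>{1..n}. a \<noteq> b \<and>
     precedes_on_line D a q p \<and> precedes_on_line D b q p}"

end

theory Submission
  imports Defs
begin

text \<open>
  The proof takes place in the algebra of the 0-Hecke monoid: generators \<open>t\<^sub>a\<close> subject to the braid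
  and commutation relations and \<open>t\<^sub>a t\<^sub>a = t\<^sub>a\<close>, with a basis \<open>t\<^sub>w\<close> indexed by permutations. Put
  \<open>h\<^sub>a(x) = (1 - x) + x t\<^sub>a\<close>, and let \<open>G\<close> be the product of the factors \<open>h\<^sub>a(x\<^sub>i)\<close>,
  \<open>a = \<bar>i\<bar> + j - 1\<close>, over all positions \<open>(i, j)\<close> of the double diagram (with \<open>x\<^sub>-\<^sub>k = y\<^sub>k\<close>), ordered so that the letters
  at a double rc-graph for \<open>w = v\<^sup>-\<^sup>1 u\<close> spell the reversed word of \<open>v\<close> followed by the word of \<open>u\<close>.
  Both formulas express the coefficient of \<open>t\<^sub>w\<close> in \<open>G\<close>, and this coefficient is \<open>double_H n w\<close>.

  The coefficient is \<open>double_H n w\<close> (lemma \<open>double_H_eq_coeff\<close>) for two reasons. First, the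
  Yang--Baxter equation lets the rows of the upper diagram pass through those of the lower one, which
  turns \<open>G\<close> into a product of factors \<open>h\<^sub>a(x\<^sub>i + y\<^sub>j - x\<^sub>i y\<^sub>j)\<close>, one for each \<open>i + j \<le> n\<close>
  (\<open>staircase_absorb_rows\<close>). Its letters form a reduced word of the longest permutation, so the
  coefficient there is the product of all \<open>x\<^sub>i + y\<^sub>j - x\<^sub>i y\<^sub>j\<close>. Second, two rows with the same letters
  commute (\<open>rows_commute\<close>). Hence \<open>(1 - x\<^sub>i\<^sub>+\<^sub>1) G = S (1 - x\<^sub>i\<^sub>+\<^sub>1 t\<^sub>i)\<close> with \<open>S\<close> symmetric in
  \<open>x\<^sub>i\<close> and \<open>x\<^sub>i\<^sub>+\<^sub>1\<close>, and the divided difference of this is \<open>S t\<^sub>i = G t\<^sub>i\<close> (\<open>pi_op_act\<close>). Comparing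
  coefficients shows that \<open>mu_op i\<close> takes the coefficient at \<open>w\<close> to the one at \<open>w s\<^sub>i\<close> whenever
  \<open>w s\<^sub>i\<close> is shorter than \<open>w\<close>, which is the recursion that defines \<open>double_H\<close>.

  Expanding \<open>G\<close> gives the coefficient as a sum over all sets of positions whose letters multiply to
  \<open>t\<^sub>w\<close>. Read such a set from left to right and drop every letter that does not lengthen the product
  of the letters kept so far. What remains is a double rc-graph \<open>D\<close>, and the positions that could have
  been dropped on the way to \<open>D\<close> are determined by \<open>D\<close>; each of them occurs both inside and outside
  the set, contributing \<open>x + (1 - x) = 1\<close> (\<open>act_delta_subwords\<close>). Reading from right to left instead
  gives a second such expansion, because reversing all words inverts the permutation
  (\<open>coeff_at_rev\<close>).

  It remains to recognize the dropped positions. The lines of a diagram are the wires of its word, swept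
  from the last letter to the first: just before a position with letter \<open>a\<close> is swept, the two lines that
  meet there are the wires \<open>a\<close> and \<open>a + 1\<close> (\<open>line_visits_iff\<close>). In a reduced word two wires that start
  in order end out of order exactly if they cross (\<open>inversion_iff_crossing\<close>), so a letter does not
  lengthen the product of the letters on its left exactly if the two lines cross later, and it does not
  lengthen the product of the letters on its right exactly if they have crossed before.
\<close>

section \<open>Weighted words of 0-Hecke generators\<close>

text \<open>Right multiplication by a generator of the 0-Hecke monoid, acting on one-line notation: it sorts
  the entries at \<open>a\<close> and \<open>a + 1\<close> into decreasing order. The relations of the monoid are those of
  bubble sort and hold for arbitrary functions, not only for permutations.\<close>
definition sort_step :: "nat \<Rightarrow> (nat \<Rightarrow> nat) \<Rightarrow> nat \<Rightarrow> nat" where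
  "sort_step a w = (if w a < w (Suc a) then w \<circ> simple_refl a else w)"

lemma simple_refl_apply:
  "simple_refl a k = (if k = a then Suc a else if k = Suc a then a else k)"
  by (simp add: simple_refl_def transpose_def)

lemma simple_refl_simps [simp]:
  "simple_refl a a = Suc a" "simple_refl a (Suc a) = a"
  "simple_refl a (simple_refl a k) = k"
  by (simp_all add: simple_refl_apply)

lemma sort_step_eq:
  "sort_step a w = (\<lambda>k. if k = a then max (w a) (w (Suc a))
                        else if k = Suc a then min (w a) (w (Suc a)) else w k)"
  by (auto simp: sort_step_def simple_refl_apply fun_eq_iff max_def min_def)

lemma sort_step_idem: "sort_step a (sort_step a w) = sort_step a w"
  by (auto simp: sort_step_eq fun_eq_iff)

lemma sort_step_braid:
  "sort_step a (sort_step (Suc a) (sort_step a w)) =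
   sort_step (Suc a) (sort_step a (sort_step (Suc a) w))"
  by (auto simp: sort_step_eq fun_eq_iff max_def min_def)

lemma sort_step_comm:
  "Suc a < b \<Longrightarrow> sort_step a (sort_step b w) = sort_step b (sort_step a w)"
  by (auto simp: sort_step_eq fun_eq_iff)

text \<open>The letter \<open>(a, p, q)\<close> stands for the element \<open>p + q t\<^sub>a\<close> of the 0-Hecke algebra.\<close>
type_synonym 'r letter = "nat \<times> 'r \<times> 'r"

text \<open>A list of letters stands for their product in the 0-Hecke algebra. Instead of the algebra itself we
  use its right action on the basis, dualized: if \<open>t\<^sub>w\<close> times the product is
  \<open>\<Sum>v. c\<^sub>v t\<^sub>v\<close>, then \<open>act L \<phi> w\<close> is \<open>\<Sum>v. c\<^sub>v \<phi>(v)\<close>. Testing against arbitrary \<open>\<phi>\<close> avoids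
  every finiteness question, and the action of a generator needs no case distinction.\<close>
fun act :: "'r::comm_ring_1 letter list \<Rightarrow> ((nat \<Rightarrow> nat) \<Rightarrow> 'r) \<Rightarrow> (nat \<Rightarrow> nat) \<Rightarrow> 'r" where
  "act [] \<phi> w = \<phi> w"
| "act ((a, p, q) # L) \<phi> w = p * act L \<phi> w + q * act L \<phi> (sort_step a w)"

lemma act_append: "act (L @ M) \<phi> = act L (act M \<phi>)"
proof (induction L)
  case (Cons l L) then show ?case by (cases l) (auto simp: fun_eq_iff)
qed (auto simp: fun_eq_iff)

lemma act_linear: "act L (\<lambda>w. p * \<phi> w + q * \<psi> w) w = p * act L \<phi> w + q * act L \<psi> w"
proof (induction L arbitrary: w)
  case (Cons l L) then show ?case by (cases l) (auto simp: algebra_simps)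
qed auto

lemma act_cong_scaled:
  assumes "\<And>w. \<phi> w = c * \<psi> w" shows "act L \<phi> w = c * act L \<psi> w"
proof -
  have "\<phi> = (\<lambda>w. c * \<psi> w + 0 * \<psi> w)" using assms by auto
  then show ?thesis by (simp only: act_linear) simp
qed

definition equiv_words :: "'r::comm_ring_1 letter list \<Rightarrow> 'r letter list \<Rightarrow> bool" (infix "\<approx>" 50) where
  "L \<approx> M \<longleftrightarrow> act L = act M"

lemma equiv_refl: "L \<approx> L" by (simp add: equiv_words_def)
lemma equiv_sym: "L \<approx> M \<Longrightarrow> M \<approx> L" by (simp add: equiv_words_def)
lemma equiv_trans [trans]: "L \<approx> M \<Longrightarrow> M \<approx> N \<Longrightarrow> L \<approx> N" by (simp add: equiv_words_def)
lemma equiv_append: "L \<approx> L' \<Longrightarrow> M \<approx> M' \<Longrightarrow> L @ M \<approx> L' @ M'"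
  unfolding equiv_words_def by (rule ext) (simp add: act_append)
lemma equiv_mid: "M \<approx> M' \<Longrightarrow> L @ M @ N \<approx> L @ M' @ N"
  by (intro equiv_append equiv_refl)

text \<open>The factor \<open>h\<^sub>a(x)\<close>. These multiply by \<open>h\<^sub>a(x) h\<^sub>a(y) = h\<^sub>a(x + y - x y)\<close>.\<close>
abbreviation hecke :: "nat \<Rightarrow> 'r::comm_ring_1 \<Rightarrow> 'r letter" where
  "hecke a x \<equiv> (a, 1 - x, x)"

text \<open>The multiplicative formal group law.\<close>
abbreviation formal_sum :: "'r::comm_ring_1 \<Rightarrow> 'r \<Rightarrow> 'r" (infixl "\<oplus>" 65) where
  "x \<oplus> y \<equiv> x + y - x * y"

lemma yang_baxter:
  "[hecke a y, hecke (Suc a) (x \<oplus> y), hecke a x] \<approx> [hecke (Suc a) x, hecke a (x \<oplus> y), hecke (Suc a) y]"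
  unfolding equiv_words_def
  by (auto simp: fun_eq_iff sort_step_idem sort_step_braid algebra_simps)

lemma letters_commute:
  assumes "Suc (fst k) < fst l \<or> Suc (fst l) < fst k" shows "[k, l] \<approx> [l, k]"
proof -
  have "sort_step (fst k) (sort_step (fst l) w) = sort_step (fst l) (sort_step (fst k) w)" for w
    using assms sort_step_comm by metis
  then show ?thesis
    by (cases k; cases l) (simp add: equiv_words_def algebra_simps ext)
qed

lemma letter_word_commute:
  assumes "\<forall>l\<in>set L. Suc (fst k) < fst l \<or> Suc (fst l) < fst k"
  shows "k # L \<approx> L @ [k]"
  using assms
proof (induction L)
  case (Cons l L)
  have "[k, l] @ L \<approx> [l, k] @ L"
    using Cons.prems by (intro equiv_append letters_commute equiv_refl) auto
  also have "[l, k] @ L = [l] @ (k # L)" by simp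
  also have "[l] @ (k # L) \<approx> [l] @ (L @ [k])"
    using Cons by (intro equiv_append equiv_refl Cons.IH) auto
  finally show ?case by simp
qed (simp add: equiv_refl)

lemma words_commute:
  assumes "\<forall>k\<in>set K. \<forall>l\<in>set L. Suc (fst k) < fst l \<or> Suc (fst l) < fst k"
  shows "K @ L \<approx> L @ K"
  using assms
proof (induction K)
  case (Cons k K)
  have "[k] @ (K @ L) \<approx> [k] @ (L @ K)"
    using Cons by (intro equiv_append equiv_refl Cons.IH) auto
  also have "[k] @ (L @ K) = (k # L) @ K" by simp
  also have "(k # L) @ K \<approx> (L @ [k]) @ K"
    using Cons.prems by (intro equiv_append letter_word_commute equiv_refl) auto
  finally show ?case by simp
qed (simp add: equiv_refl)

section \<open>Rows of a diagram and the Yang--Baxter equation\<close>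

text \<open>The factors \<open>h\<^sub>a(x)\<close> with \<open>a\<close> descending from \<open>i + d - 1\<close> to \<open>i\<close>. Row \<open>i\<close> of the lower diagram is
  the case \<open>d = n - i\<close>; recursing on \<open>d\<close> keeps the greatest letter fixed while \<open>i\<close> grows.\<close>
fun desc_row :: "nat \<Rightarrow> nat \<Rightarrow> 'r::comm_ring_1 \<Rightarrow> 'r letter list" where
  "desc_row 0 i x = []"
| "desc_row (Suc d) i x = desc_row d (Suc i) x @ [hecke i x]"

abbreviation asc_row :: "nat \<Rightarrow> nat \<Rightarrow> 'r::comm_ring_1 \<Rightarrow> 'r letter list" where
  "asc_row d i y \<equiv> rev (desc_row d i y)"

lemma desc_row_eq: "desc_row d i x = map (\<lambda>a. hecke a x) (rev [i..<i + d])"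
proof (induction d arbitrary: i)
  case (Suc d) show ?case by (subst upt_conv_Cons) (simp_all add: Suc)
qed simp

lemma set_desc_row: "set (desc_row d i x) = (\<lambda>a. hecke a x) ` {i..<i + d}"
  by (auto simp: desc_row_eq)

text \<open>The greatest letters of the two rows meet in the middle and merge to
  \<open>h(x \<oplus> y)\<close>. The Yang--Baxter equation then lets this merged factor descend through the smaller
  letters, one letter at a time, exchanging the two rows on the way.\<close>
lemma asc_desc_row:
  "asc_row (Suc d) i y @ desc_row (Suc d) i x \<approx>
   desc_row d (Suc i) x @ [hecke i (x \<oplus> y)] @ asc_row d (Suc i) y"
proof (induction d arbitrary: i)
  case 0
  show ?case by (auto simp: equiv_words_def fun_eq_iff sort_step_idem algebra_simps)
next
  case (Suc d)
  let ?A = "desc_row d (Suc (Suc i)) x" and ?A' = "asc_row d (Suc (Suc i)) y"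
  have "[hecke i y] @ (asc_row (Suc d) (Suc i) y @ desc_row (Suc d) (Suc i) x) @ [hecke i x] \<approx>
        [hecke i y] @ (?A @ [hecke (Suc i) (x \<oplus> y)] @ ?A') @ [hecke i x]"
    by (rule equiv_mid) (rule Suc)
  also have "\<dots> = ([hecke i y] @ ?A) @ [hecke (Suc i) (x \<oplus> y)] @ (?A' @ [hecke i x])" by simp
  also have "\<dots> \<approx> (?A @ [hecke i y]) @ [hecke (Suc i) (x \<oplus> y)] @ ([hecke i x] @ ?A')"
    by (intro equiv_append words_commute equiv_refl) (auto simp: set_desc_row)
  also have "\<dots> = ?A @ [hecke i y, hecke (Suc i) (x \<oplus> y), hecke i x] @ ?A'" by simp
  also have "\<dots> \<approx> ?A @ [hecke (Suc i) x, hecke i (x \<oplus> y), hecke (Suc i) y] @ ?A'"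
    by (rule equiv_mid) (rule yang_baxter)
  finally show ?case by simp
qed

text \<open>The upper diagram with letters at least \<open>i\<close>: row \<open>-k\<close> ascends from letter \<open>i + k - 1\<close> and carries
  \<open>y\<^sub>k\<close>, and the rows closer to the lower diagram come later.\<close>
fun staircase :: "nat \<Rightarrow> nat \<Rightarrow> (nat \<Rightarrow> 'r::comm_ring_1) \<Rightarrow> 'r letter list" where
  "staircase 0 i y = []"
| "staircase (Suc d) i y = staircase d (Suc i) (\<lambda>j. y (Suc j)) @ asc_row (Suc d) i (y 1)"

text \<open>One row of the product that the Yang--Baxter equation produces: the factors
  \<open>h\<^sub>a(x \<oplus> y\<^sub>j)\<close> with \<open>a = i + j - 1\<close>, in descending order.\<close>
fun mixed_row :: "nat \<Rightarrow> nat \<Rightarrow> 'r::comm_ring_1 \<Rightarrow> (nat \<Rightarrow> 'r) \<Rightarrow> 'r letter list" where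
  "mixed_row 0 i x y = []"
| "mixed_row (Suc d) i x y = mixed_row d (Suc i) x (\<lambda>j. y (Suc j)) @ [hecke i (x \<oplus> y 1)]"

lemma set_staircase: "l \<in> set (staircase d i y) \<Longrightarrow> i \<le> fst l"
  by (induction d arbitrary: i y) (force simp: set_desc_row)+

text \<open>The row of \<open>x\<close> passes through all rows of the upper diagram; each of them leaves one merged factor
  behind and loses its smallest letter.\<close>
lemma staircase_absorb_row:
  "staircase (Suc d) i y @ desc_row (Suc d) i x \<approx> mixed_row (Suc d) i x y @ staircase d (Suc i) y"
proof (induction d arbitrary: i y)
  case 0 show ?case by (auto simp: equiv_words_def fun_eq_iff sort_step_idem algebra_simps)
next
  case (Suc d)
  let ?S = "staircase (Suc d) (Suc i) (\<lambda>j. y (Suc j))" and ?R = "mixed_row (Suc d) (Suc i) x (\<lambda>j. y (Suc j))"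
  let ?S' = "staircase d (Suc (Suc i)) (\<lambda>j. y (Suc j))"
  let ?A' = "asc_row (Suc d) (Suc i) (y 1)"
  have "?S @ (asc_row (Suc (Suc d)) i (y 1) @ desc_row (Suc (Suc d)) i x)
     \<approx> ?S @ (desc_row (Suc d) (Suc i) x @ [hecke i (x \<oplus> y 1)] @ ?A')"
    by (intro equiv_append equiv_refl asc_desc_row)
  also have "\<dots> = (?S @ desc_row (Suc d) (Suc i) x) @ [hecke i (x \<oplus> y 1)] @ ?A'" by simp
  also have "\<dots> \<approx> (?R @ ?S') @ [hecke i (x \<oplus> y 1)] @ ?A'"
    by (intro equiv_append equiv_refl Suc)
  also have "\<dots> = ?R @ (?S' @ [hecke i (x \<oplus> y 1)]) @ ?A'" by simp
  also have "\<dots> \<approx> ?R @ ([hecke i (x \<oplus> y 1)] @ ?S') @ ?A'"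
    by (intro equiv_mid words_commute) (auto dest: set_staircase)
  finally show ?case by simp
qed

fun desc_rows :: "nat \<Rightarrow> nat \<Rightarrow> (nat \<Rightarrow> 'r::comm_ring_1) \<Rightarrow> 'r letter list" where
  "desc_rows 0 i x = []"
| "desc_rows (Suc d) i x = desc_row (Suc d) i (x i) @ desc_rows d (Suc i) x"

fun mixed_rows :: "nat \<Rightarrow> nat \<Rightarrow> (nat \<Rightarrow> 'r::comm_ring_1) \<Rightarrow> (nat \<Rightarrow> 'r) \<Rightarrow> 'r letter list" where
  "mixed_rows 0 i x y = []"
| "mixed_rows (Suc d) i x y = mixed_row (Suc d) i (x i) y @ mixed_rows d (Suc i) x y"

lemma staircase_absorb_rows: "staircase d i y @ desc_rows d i x \<approx> mixed_rows d i x y"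
proof (induction d arbitrary: i)
  case 0 show ?case by (simp add: equiv_refl)
next
  case (Suc d)
  have "(staircase (Suc d) i y @ desc_row (Suc d) i (x i)) @ desc_rows d (Suc i) x
    \<approx> (mixed_row (Suc d) i (x i) y @ staircase d (Suc i) y) @ desc_rows d (Suc i) x"
    by (intro equiv_append equiv_refl staircase_absorb_row)
  also have "\<dots> = mixed_row (Suc d) i (x i) y @ (staircase d (Suc i) y @ desc_rows d (Suc i) x)" by simp
  also have "\<dots> \<approx> mixed_row (Suc d) i (x i) y @ mixed_rows d (Suc i) x y"
    by (intro equiv_append equiv_refl Suc)
  finally show ?case by simp
qed

section \<open>Rows with the same letters commute\<close>

text \<open>The last letter of the first row is moved to the right, past the letters of the second row that are
  not adjacent to it.\<close>
lemma split_rows: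
  "desc_row (Suc (Suc e)) i x @ desc_row (Suc (Suc e)) i y \<approx>
   desc_row e (Suc (Suc i)) x @ [hecke (Suc i) x] @ desc_row e (Suc (Suc i)) y @ [hecke i x, hecke (Suc i) y, hecke i y]"
proof -
  let ?X = "desc_row e (Suc (Suc i)) x" and ?Y = "desc_row e (Suc (Suc i)) y"
  have "(?X @ [hecke (Suc i) x]) @ ([hecke i x] @ ?Y) @ [hecke (Suc i) y, hecke i y] \<approx>
        (?X @ [hecke (Suc i) x]) @ (?Y @ [hecke i x]) @ [hecke (Suc i) y, hecke i y]"
    by (intro equiv_mid words_commute) (auto simp: set_desc_row)
  then show ?thesis by simp
qed

text \<open>Induction on the number of letters. If \<open>h(x)\<close> were invertible, one could write
  \<open>h(y) = h(z) h(x)\<close>, move the factor \<open>h(z)\<close> out of the factors with the two smallest letters by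
  the Yang--Baxter equation, and use the induction hypothesis on what remains. To stay in the ring the
  whole identity is multiplied by \<open>1 - x\<close>, which can be cancelled afterwards.\<close>
lemma rows_commute:
  fixes x y :: "'r::idom"
  assumes "x \<noteq> 1"
  shows "desc_row d i x @ desc_row d i y \<approx> desc_row d i y @ desc_row d i x"
proof (induction d arbitrary: i)
  case 0 show ?case by (simp add: equiv_refl)
next
  case (Suc d)
  show ?case
  proof (cases d)
    case 0
    then show ?thesis by (auto simp: equiv_words_def fun_eq_iff sort_step_idem algebra_simps)
  next
    case (Suc e)
    let ?X = "desc_row e (Suc (Suc i)) x" and ?Y = "desc_row e (Suc (Suc i)) y"
    let ?j = "Suc i"
    \<comment> \<open>\<open>1 - x\<close> times the factor \<open>h(z)\<close> with \<open>y = z \<oplus> x\<close>\<close>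
    let ?k = "\<lambda>a. (a, 1 - y, y - x)"
    have IH: "?X @ [hecke ?j x] @ ?Y @ [hecke ?j y] \<approx> ?Y @ [hecke ?j y] @ ?X @ [hecke ?j x]"
      using Suc.IH[of ?j] Suc by simp
    have k: "act [?k a, hecke a x] \<phi> w = (1 - x) * act [hecke a y] \<phi> w" for a \<phi> w
      by (simp add: sort_step_idem algebra_simps)
    have kx: "[hecke i x, hecke ?j y, ?k i] \<approx> [?k ?j, hecke i y, hecke ?j x]"
      by (auto simp: equiv_words_def fun_eq_iff sort_step_idem sort_step_braid algebra_simps)
    have main: "(1 - x) * act (?X @ [hecke ?j x] @ ?Y @ [hecke i x, hecke ?j y, hecke i y]) \<phi> w
       = (1 - x) * act (?Y @ [hecke ?j y] @ ?X @ [hecke i y, hecke ?j x, hecke i x]) \<phi> w" for \<phi> w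
    proof -
      have scale: "act (L @ [?k a, hecke a x] @ M) \<phi> w = (1 - x) * act (L @ [hecke a y] @ M) \<phi> w"
        for L M a \<phi> w
        unfolding act_append by (rule act_cong_scaled) (rule k)
      have 2: "act (?X @ [hecke ?j x] @ ?Y @ [?k ?j]) \<psi> w = (1 - x) * act (?Y @ [hecke ?j y] @ ?X) \<psi> w" for \<psi> w
      proof -
        \<comment> \<open>\<open>1 - x t\<close> is \<open>1 - x\<close> times the inverse of \<open>h(x)\<close>\<close>
        have inv: "act [hecke ?j x, (?j, 1, - x)] \<psi> w = (1 - x) * \<psi> w" for \<psi> w
          by (simp add: sort_step_idem algebra_simps)
        have 3: "act (L @ [hecke ?j x, (?j, 1, - x)]) \<psi> w = (1 - x) * act L \<psi> w" for L \<psi> w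
          unfolding act_append by (rule act_cong_scaled) (rule inv)
        have "[hecke ?j y, (?j, 1, - x)] \<approx> [?k ?j]"
          by (auto simp: equiv_words_def fun_eq_iff sort_step_idem algebra_simps)
        from equiv_append[OF equiv_refl this, of "?X @ [hecke ?j x] @ ?Y"]
        have "act (?X @ [hecke ?j x] @ ?Y @ [?k ?j]) \<psi> w
            = act ((?X @ [hecke ?j x] @ ?Y) @ [hecke ?j y, (?j, 1, - x)]) \<psi> w"
          by (simp add: equiv_words_def)
        also have "\<dots> = act ((?Y @ [hecke ?j y] @ ?X @ [hecke ?j x]) @ [(?j, 1, - x)]) \<psi> w"
          using equiv_append[OF IH equiv_refl[of "[(?j, 1, - x)]"]] by (simp add: equiv_words_def)
        also have "\<dots> = (1 - x) * act (?Y @ [hecke ?j y] @ ?X) \<psi> w"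
          using 3[of "?Y @ [hecke ?j y] @ ?X" \<psi> w] by simp
        finally show ?thesis by simp
      qed
      have "(1 - x) * act (?X @ [hecke ?j x] @ ?Y @ [hecke i x, hecke ?j y, hecke i y]) \<phi> w
          = act (?X @ [hecke ?j x] @ ?Y @ [hecke i x, hecke ?j y, ?k i, hecke i x]) \<phi> w"
        using scale[of "?X @ [hecke ?j x] @ ?Y @ [hecke i x, hecke ?j y]" i "[]" \<phi> w] by simp
      also have "\<dots> = act ((?X @ [hecke ?j x] @ ?Y) @ [?k ?j, hecke i y, hecke ?j x] @ [hecke i x]) \<phi> w"
        using equiv_mid[OF kx, of "?X @ [hecke ?j x] @ ?Y" "[hecke i x]"] by (simp add: equiv_words_def)
      also have "\<dots> = act ((?X @ [hecke ?j x] @ ?Y @ [?k ?j]) @ [hecke i y, hecke ?j x, hecke i x]) \<phi> w" by simp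
      also have "\<dots> = (1 - x) * act (?Y @ [hecke ?j y] @ ?X) (act [hecke i y, hecke ?j x, hecke i x] \<phi>) w"
        by (subst act_append) (rule 2)
      also have "\<dots> = (1 - x) * act (?Y @ [hecke ?j y] @ ?X @ [hecke i y, hecke ?j x, hecke i x]) \<phi> w"
        unfolding act_append ..
      finally show ?thesis .
    qed
    have "?X @ [hecke ?j x] @ ?Y @ [hecke i x, hecke ?j y, hecke i y] \<approx> ?Y @ [hecke ?j y] @ ?X @ [hecke i y, hecke ?j x, hecke i x]"
      using main assms unfolding equiv_words_def fun_eq_iff by simp
    from equiv_trans[OF split_rows equiv_trans[OF this equiv_sym[OF split_rows]]]
    show ?thesis unfolding Suc .
  qed
qed

section \<open>Exchanging two variables\<close>

definition swap_exponents :: "nat \<Rightarrow> (int \<Rightarrow>\<^sub>0 nat) \<Rightarrow> (int \<Rightarrow>\<^sub>0 nat)" where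
  "swap_exponents i = Poly_Mapping.map_key (transpose (int i) (int (i + 1)))"

lemma inj_transpose: "inj (transpose a b)"
  by (metis inj_on_inverseI transpose_involutory)

lemma swap_exponents_involutory: "swap_exponents i (swap_exponents i m) = m"
  by (rule poly_mapping_eqI) (simp add: swap_exponents_def Poly_Mapping.map_key.rep_eq inj_transpose)

lemma inj_swap_exponents: "inj (swap_exponents i)"
  by (metis inj_on_inverseI swap_exponents_involutory)

lemma swap_exponents_plus: "swap_exponents i (m + m') = swap_exponents i m + swap_exponents i m'"
  unfolding swap_exponents_def by (rule Poly_Mapping.map_key_plus) (rule inj_transpose)

lemma swap_exponents_single:
  "swap_exponents i (Poly_Mapping.single k c) =
   Poly_Mapping.single (transpose (int i) (int (i + 1)) k) c"
  using Poly_Mapping.map_key_single[OF inj_transpose[of "int i" "int (i + 1)"], of "transpose (int i) (int (i + 1)) k" c]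
  by (simp add: swap_exponents_def)

lemma swap_vars_plus: "swap_vars i (f + g) = swap_vars i f + swap_vars i g"
  unfolding swap_vars_def swap_exponents_def[symmetric]
  by (rule Poly_Mapping.map_key_plus) (rule inj_swap_exponents)

lemma swap_vars_single:
  "swap_vars i (Poly_Mapping.single m c) = Poly_Mapping.single (swap_exponents i m) c"
  using Poly_Mapping.map_key_single[OF inj_swap_exponents[of i], of "swap_exponents i m" c]
  unfolding swap_vars_def swap_exponents_def[symmetric] by (simp add: swap_exponents_involutory)

lemma poly_sum_of_monomials:
  fixes f :: xy_poly
  shows "f = (\<Sum>m\<in>Poly_Mapping.keys f. Poly_Mapping.single m (Poly_Mapping.lookup f m))"
  by (rule poly_mapping_eqI)
     (auto simp: lookup_sum lookup_single when_def in_keys_iff sum.delta' intro: sym)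

lemma swap_vars_0 [simp]: "swap_vars i 0 = 0"
  using swap_vars_plus[of i 0 0] by simp

lemma swap_vars_sum: "swap_vars i (\<Sum>k\<in>K. f k) = (\<Sum>k\<in>K. swap_vars i (f k))"
  by (induction K rule: infinite_finite_induct) (simp_all add: swap_vars_plus)

lemma swap_vars_times: "swap_vars i (f * g) = swap_vars i f * swap_vars i g"
proof -
  have "swap_vars i (Poly_Mapping.single m c * Poly_Mapping.single m' c') =
     swap_vars i (Poly_Mapping.single m c) * swap_vars i (Poly_Mapping.single m' c')" for m m' c c'
    by (simp add: mult_single swap_vars_single swap_exponents_plus)
  then show ?thesis
    by (subst (1 2) poly_sum_of_monomials, subst (3 4) poly_sum_of_monomials)
       (simp only: swap_vars_sum sum_product)
qed

lemma swap_vars_1 [simp]: "swap_vars i 1 = 1"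
  using swap_vars_single[of i 0 1] Poly_Mapping.map_key_zero[OF inj_transpose]
  by (simp add: swap_exponents_def)

lemma swap_vars_minus: "swap_vars i (f - g) = swap_vars i f - swap_vars i g"
  using swap_vars_plus[of i "f - g" g] by (simp add: algebra_simps)

lemma swap_vars_Var: "swap_vars i (Var k) = Var (transpose (int i) (int (i + 1)) k)"
  by (simp only: Var_def swap_vars_single swap_exponents_single)

lemma Var_inject: "Var j = Var k \<longleftrightarrow> j = k"
  by (auto simp: Var_def dest!: arg_cong[where f = Poly_Mapping.keys])

lemma Var_neq_1: "Var j \<noteq> 1"
  unfolding Var_def single_one[symmetric]
  by (auto dest!: arg_cong[where f = Poly_Mapping.keys] simp del: single_one)

text \<open>The quotient is unique because the polynomials form an integral domain.\<close>
lemma pi_op_eqI: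
  assumes "(X i - X (i + 1)) * g = (1 - X (i + 1)) * f - swap_vars i ((1 - X (i + 1)) * f)"
  shows "pi_op i f = g"
  unfolding pi_op_def
proof (rule the_equality)
  have "X i - X (i + 1) \<noteq> 0" by (simp add: Var_inject)
  then show "g' = g" if "(X i - X (i + 1)) * g' =
      (1 - X (i + 1)) * f - swap_vars i ((1 - X (i + 1)) * f)" for g'
    using that assms by (metis mult_cancel_left)
qed (rule assms)

section \<open>The operators \<open>mu_op\<close> on coefficients\<close>

lemma swap_vars_act:
  assumes "\<And>w. swap_vars i (\<phi> w) = \<phi> w"
  shows "swap_vars i (act L \<phi> w) =
    act (map (\<lambda>(a, p, q). (a, swap_vars i p, swap_vars i q)) L) \<phi> w"
proof (induction L arbitrary: w)
  case (Cons l L) then show ?case by (cases l) (simp add: swap_vars_plus swap_vars_times)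
qed (simp add: assms)

lemma swap_desc_row: "map (\<lambda>(a, p, q). (a, swap_vars i p, swap_vars i q)) (desc_row d k x) =
   desc_row d k (swap_vars i x)"
  by (simp add: desc_row_eq swap_vars_minus)

text \<open>With \<open>y = x\<^sub>i\<^sub>+\<^sub>1\<close>, completing the second row by \<open>h\<^sub>i(y)\<close> makes the word symmetric, and
  \<open>h\<^sub>i(y) (1 - y t\<^sub>i) = 1 - y\<close> undoes the completion. Thus \<open>1 - y\<close> times the word is
  \<open>S (1 - y t\<^sub>i)\<close> with \<open>S\<close> symmetric, since \<open>t\<^sub>i\<close> commutes with all later letters. The divided
  difference replaces the coefficients \<open>1\<close> and \<open>-y\<close> by \<open>0\<close> and \<open>1\<close>, leaving \<open>S t\<^sub>i\<close>, and
  \<open>h\<^sub>i(y) t\<^sub>i = t\<^sub>i\<close> removes the completion again.\<close>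
lemma pi_op_act:
  fixes P Q :: "xy_poly letter list" and i d
  defines "L \<equiv> P @ desc_row (Suc d) i (X i) @ desc_row d (Suc i) (X (Suc i)) @ Q"
  assumes fixed: "\<And>a p q. (a, p, q) \<in> set P \<union> set Q \<Longrightarrow> swap_vars i p = p \<and> swap_vars i q = q"
    and above: "\<And>l. l \<in> set Q \<Longrightarrow> Suc i < fst l"
    and const: "\<And>w. swap_vars i (\<phi> w) = \<phi> w"
  shows "pi_op i (act L \<phi> w) = act L (\<lambda>v. \<phi> (sort_step i v)) w"
proof -
  let ?x = "X i" and ?y = "X (Suc i)"
  define S where "S = P @ desc_row (Suc d) i ?x @ desc_row (Suc d) i ?y @ Q"
  let ?\<phi>' = "\<lambda>v. \<phi> (sort_step i v)"
  have swapx: "swap_vars i ?x = ?y" and swapy: "swap_vars i ?y = ?x"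
    by (simp_all add: swap_vars_Var)
  have scale: "(1 - ?y) * act L \<phi> w = act S \<phi> w - ?y * act S ?\<phi>' w"
  proof -
    let ?l = "(i, 1, - ?y)"
    let ?A = "P @ desc_row (Suc d) i ?x @ desc_row d (Suc i) ?y"
    have "(1 - ?y) * act L \<phi> w = (1 - ?y) * act ?A (act Q \<phi>) w"
      by (simp only: L_def act_append)
    also have "\<dots> = act ?A (act [hecke i ?y, ?l] (act Q \<phi>)) w"
      by (rule act_cong_scaled[symmetric]) (simp add: sort_step_idem algebra_simps)
    also have "\<dots> = act (?A @ [hecke i ?y, ?l] @ Q) \<phi> w" by (simp only: act_append)
    also have "\<dots> = act ((P @ desc_row (Suc d) i ?x @ desc_row (Suc d) i ?y) @ (?l # Q)) \<phi> w"
      by simp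
    also have "\<dots> = act ((P @ desc_row (Suc d) i ?x @ desc_row (Suc d) i ?y) @ (Q @ [?l])) \<phi> w"
      using equiv_append[OF equiv_refl letter_word_commute[of Q ?l], of "P @ desc_row (Suc d) i ?x @ desc_row (Suc d) i ?y"]
        above by (simp add: equiv_words_def)
    also have "\<dots> = act (S @ [?l]) \<phi> w" by (simp add: S_def)
    also have "\<dots> = act S (\<lambda>v. 1 * \<phi> v + (- ?y) * ?\<phi>' v) w"
      unfolding act_append by (rule arg_cong[where f = "\<lambda>\<psi>. act S \<psi> w"]) (simp add: fun_eq_iff)
    also have "\<dots> = act S \<phi> w - ?y * act S ?\<phi>' w"
      by (subst act_linear) simp
    finally show ?thesis .
  qed
  have absorb: "act L ?\<phi>' w = act S ?\<phi>' w"
  proof -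
    let ?l = "(i, 0, 1) :: xy_poly letter"
    let ?A = "P @ desc_row (Suc d) i ?x @ desc_row d (Suc i) ?y"
    have comm: "Q @ [?l] \<approx> ?l # Q"
      using letter_word_commute[of Q ?l] above by (auto intro: equiv_sym)
    have l: "[hecke i ?y, ?l] \<approx> [?l]"
      by (auto simp: equiv_words_def fun_eq_iff sort_step_idem algebra_simps)
    have last: "act M ?\<phi>' w = act (M @ [?l]) \<phi> w" for M
      unfolding act_append by (rule arg_cong[where f = "\<lambda>\<psi>. act M \<psi> w"]) (simp add: fun_eq_iff)
    have "act L ?\<phi>' w = act (?A @ (Q @ [?l])) \<phi> w"
      by (simp only: last L_def append_assoc)
    also have "\<dots> = act (?A @ (?l # Q)) \<phi> w"
      using equiv_append[OF equiv_refl comm, of ?A] by (simp add: equiv_words_def)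
    also have "\<dots> = act (?A @ [?l] @ Q) \<phi> w" by simp
    also have "\<dots> = act (?A @ [hecke i ?y, ?l] @ Q) \<phi> w"
      using equiv_mid[OF l, of ?A Q] by (simp add: equiv_words_def)
    also have "\<dots> = act ((?A @ [hecke i ?y]) @ (?l # Q)) \<phi> w" by simp
    also have "\<dots> = act ((?A @ [hecke i ?y]) @ (Q @ [?l])) \<phi> w"
      using equiv_append[OF equiv_refl comm, of "?A @ [hecke i ?y]"] by (simp add: equiv_words_def)
    also have "\<dots> = act (S @ [?l]) \<phi> w" by (simp add: S_def)
    finally show ?thesis by (simp only: last)
  qed
  have sym: "swap_vars i (act S \<psi> w) = act S \<psi> w" if "\<And>w. swap_vars i (\<psi> w) = \<psi> w" for \<psi>
  proof -
    let ?s = "map (\<lambda>(a, p, q). (a, swap_vars i p, swap_vars i q))"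
    have PQ: "?s P = P" "?s Q = Q" using fixed by (auto intro!: map_idI)
    have "swap_vars i (act S \<psi> w) =
        act (P @ (desc_row (Suc d) i ?y @ desc_row (Suc d) i ?x) @ Q) \<psi> w"
      unfolding S_def swap_vars_act[OF that] map_append swap_desc_row PQ swapx swapy by simp
    also have "\<dots> = act (P @ (desc_row (Suc d) i ?x @ desc_row (Suc d) i ?y) @ Q) \<psi> w"
      using equiv_mid[OF rows_commute[OF Var_neq_1]] by (metis equiv_words_def)
    also have "\<dots> = act S \<psi> w" by (simp add: S_def)
    finally show ?thesis .
  qed
  have "swap_vars i ((1 - ?y) * act L \<phi> w) = act S \<phi> w - ?x * act S ?\<phi>' w"
    unfolding scale swap_vars_minus swap_vars_times swapy by (simp add: sym const)
  then show ?thesis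
    using scale unfolding absorb by (intro pi_op_eqI) (simp add: algebra_simps)
qed

text \<open>The coefficient of \<open>t\<^sub>w\<close> in the product of the letters of \<open>L\<close>.\<close>
definition coeff_at :: "'r::comm_ring_1 letter list \<Rightarrow> (nat \<Rightarrow> nat) \<Rightarrow> 'r" where
  "coeff_at L w = act L (\<lambda>v. of_bool (v = w)) id"

lemma sort_step_eq_iff:
  assumes "w (Suc i) < w i"
  shows "sort_step i v = w \<longleftrightarrow> v = w \<or> v = w \<circ> simple_refl i"
proof -
  have inv: "v \<circ> simple_refl i \<circ> simple_refl i = v" for v by (auto simp: fun_eq_iff)
  have "sort_step i w = w" using assms by (simp add: sort_step_def)
  moreover have "sort_step i (w \<circ> simple_refl i) = w" using assms inv by (simp add: sort_step_def)
  moreover have "v = w \<or> v = w \<circ> simple_refl i" if "sort_step i v = w"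
    using that inv[of v] by (auto simp: sort_step_def split: if_splits)
  ultimately show ?thesis by blast
qed

text \<open>At a permutation \<open>w\<close> with a descent at \<open>i\<close>, right multiplication by \<open>t\<^sub>i\<close> collects the
  coefficients at \<open>w\<close> and at \<open>w s\<^sub>i\<close>; subtracting the identity leaves the latter.\<close>
lemma mu_op_coeff_at:
  fixes P Q :: "xy_poly letter list" and i d
  defines "L \<equiv> P @ desc_row (Suc d) i (X i) @ desc_row d (Suc i) (X (Suc i)) @ Q"
  assumes fixed: "\<And>a p q. (a, p, q) \<in> set P \<union> set Q \<Longrightarrow> swap_vars i p = p \<and> swap_vars i q = q"
    and above: "\<And>l. l \<in> set Q \<Longrightarrow> Suc i < fst l"
    and desc: "w (Suc i) < w i"
  shows "mu_op i (coeff_at L w) = coeff_at L (w \<circ> simple_refl i)"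
proof -
  let ?w' = "w \<circ> simple_refl i"
  have "w \<noteq> ?w'" using desc by (metis comp_apply less_irrefl simple_refl_simps(1))
  then have delta: "of_bool (sort_step i v = w) = 1 * of_bool (v = w) + 1 * (of_bool (v = ?w') :: xy_poly)" for v
    unfolding sort_step_eq_iff[where w = w, OF desc] by auto
  have "pi_op i (coeff_at L w) = act L (\<lambda>v. of_bool (sort_step i v = w)) id"
    unfolding coeff_at_def L_def by (rule pi_op_act) (use fixed above in auto)
  also have "\<dots> = coeff_at L w + coeff_at L ?w'"
    unfolding delta act_linear coeff_at_def by simp
  finally show ?thesis by (simp add: mu_op_def)
qed

lemma set_desc_rows:
  "l \<in> set (desc_rows d k x) \<Longrightarrow> k \<le> fst l \<and> (\<exists>j\<ge>k. snd l = (1 - x j, x j))"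
proof (induction d arbitrary: k)
  case (Suc d)
  then consider "l \<in> set (desc_row (Suc d) k (x k))" | "l \<in> set (desc_rows d (Suc k) x)" by auto
  then show ?case
  proof cases
    case 1 then show ?thesis unfolding set_desc_row by auto
  next
    case 2
    with Suc.IH obtain j where "Suc k \<le> fst l" "j \<ge> Suc k" "snd l = (1 - x j, x j)" by blast
    then show ?thesis by (auto intro!: exI[of _ j])
  qed
qed simp

text \<open>The factors preceding rows \<open>i\<close> and \<open>i + 1\<close>, and those following them, are free of
  \<open>x\<^sub>i\<close> and \<open>x\<^sub>i\<^sub>+\<^sub>1\<close>, and the latter have letters that commute with \<open>t\<^sub>i\<close>.\<close>
lemma split_desc_rows:
  assumes "k \<le> i" "i < k + d"
  shows "\<exists>P Q e. desc_rows d k x = P @ desc_row (Suc e) i (x i) @ desc_row e (Suc i) (x (Suc i)) @ Q \<and>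
    (\<forall>l\<in>set P. \<exists>j. j \<noteq> i \<and> j \<noteq> Suc i \<and> snd l = (1 - x j, x j)) \<and>
    (\<forall>l\<in>set Q. Suc i < fst l \<and> (\<exists>j. j \<noteq> i \<and> j \<noteq> Suc i \<and> snd l = (1 - x j, x j)))"
  using assms
proof (induction d arbitrary: k)
  case (Suc d)
  show ?case
  proof (cases "k = i")
    case False
    then obtain P Q e where "desc_rows d (Suc k) x = P @ desc_row (Suc e) i (x i) @ desc_row e (Suc i) (x (Suc i)) @ Q"
      and "\<forall>l\<in>set P. \<exists>j. j \<noteq> i \<and> j \<noteq> Suc i \<and> snd l = (1 - x j, x j)"
      and "\<forall>l\<in>set Q. Suc i < fst l \<and> (\<exists>j. j \<noteq> i \<and> j \<noteq> Suc i \<and> snd l = (1 - x j, x j))"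
      using Suc.IH[of "Suc k"] Suc.prems by auto
    then show ?thesis
      using False Suc.prems
      by (intro exI[of _ "desc_row (Suc d) k (x k) @ P"] exI[of _ Q] exI[of _ e])
         (auto simp: set_desc_row simp del: desc_row.simps)
  next
    case True
    show ?thesis
    proof (cases d)
      case 0
      then show ?thesis using True by (intro exI[of _ "[]"] exI[of _ 0]) auto
    next
      case (Suc e)
      have "Suc i < fst l \<and> (\<exists>j. j \<noteq> i \<and> j \<noteq> Suc i \<and> snd l = (1 - x j, x j))"
        if l: "l \<in> set (desc_rows e (Suc (Suc i)) x)" for l
      proof -
        obtain j where "Suc (Suc i) \<le> fst l" "j \<ge> Suc (Suc i)" "snd l = (1 - x j, x j)"
          using set_desc_rows[OF l] by blast
        then show ?thesis by (auto intro!: exI[of _ j])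
      qed
      then show ?thesis using True Suc
        by (intro exI[of _ "[]"] exI[of _ d] exI[of _ "desc_rows e (Suc (Suc i)) x"]) simp
    qed
  qed
qed simp

definition double_word :: "nat \<Rightarrow> xy_poly letter list" where
  "double_word n = staircase (n - 1) 1 Y @ desc_rows (n - 1) 1 X"

lemma staircase_coeffs: "l \<in> set (staircase d k y) \<Longrightarrow> \<exists>j\<ge>1. snd l = (1 - y j, y j)"
proof (induction d arbitrary: k y)
  case (Suc d)
  then consider "l \<in> set (desc_row (Suc d) k (y 1))" | "l \<in> set (staircase d (Suc k) (\<lambda>j. y (Suc j)))"
    by auto
  then show ?case
  proof cases
    case 1 then show ?thesis unfolding set_desc_row by auto
  next
    case 2
    with Suc.IH obtain j where "j \<ge> 1" "snd l = (1 - y (Suc j), y (Suc j))" by blast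
    then show ?thesis by (auto intro!: exI[of _ "Suc j"])
  qed
qed simp

lemma mu_op_double_word:
  assumes "1 \<le> i" "i < n" "w (Suc i) < w i"
  shows "mu_op i (coeff_at (double_word n) w) = coeff_at (double_word n) (w \<circ> simple_refl i)"
proof -
  obtain P Q e where rows: "desc_rows (n - 1) 1 X = P @ desc_row (Suc e) i (X i) @ desc_row e (Suc i) (X (Suc i)) @ Q"
    and P: "\<forall>l\<in>set P. \<exists>j. j \<noteq> i \<and> j \<noteq> Suc i \<and> snd l = (1 - X j, X j)"
    and Q: "\<forall>l\<in>set Q. Suc i < fst l \<and> (\<exists>j. j \<noteq> i \<and> j \<noteq> Suc i \<and> snd l = (1 - X j, X j))"
    using split_desc_rows[of 1 i "n - 1" X] assms by auto
  have fixY: "swap_vars i (Y j) = Y j" if "j \<ge> 1" for j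
    using that by (simp add: swap_vars_Var transpose_def)
  have fixX: "swap_vars i (X j) = X j" if "j \<noteq> i" "j \<noteq> Suc i" for j
    using that by (simp add: swap_vars_Var transpose_def)
  let ?P = "staircase (n - 1) 1 Y @ P"
  have "mu_op i (coeff_at (?P @ desc_row (Suc e) i (X i) @ desc_row e (Suc i) (X (Suc i)) @ Q) w)
     = coeff_at (?P @ desc_row (Suc e) i (X i) @ desc_row e (Suc i) (X (Suc i)) @ Q) (w \<circ> simple_refl i)"
  proof (rule mu_op_coeff_at)
    fix a p q assume "(a, p, q) \<in> set ?P \<union> set Q"
    then have "(\<exists>j\<ge>1. (p, q) = (1 - Y j, Y j)) \<or> (\<exists>j. j \<noteq> i \<and> j \<noteq> Suc i \<and> (p, q) = (1 - X j, X j))"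
      using bspec[OF P, of "(a, p, q)"] bspec[OF Q, of "(a, p, q)"] staircase_coeffs[of "(a, p, q)" "n - 1" 1 Y]
      unfolding snd_conv set_append by blast
    then show "swap_vars i p = p \<and> swap_vars i q = q"
      by (auto simp: swap_vars_minus fixX fixY)
  qed (use Q assms in auto)
  then show ?thesis by (simp only: double_word_def rows append_assoc)
qed

section \<open>Length and reduced words\<close>

definition word_perm :: "nat list \<Rightarrow> nat \<Rightarrow> nat" where
  "word_perm as = foldr (\<lambda>a u. simple_refl a \<circ> u) as id"

lemma word_perm_simps [simp]:
  "word_perm [] = id" "word_perm (a # as) = simple_refl a \<circ> word_perm as"
  by (simp_all add: word_perm_def)

text \<open>Every letter, multiplied from the right in turn, lengthens the permutation reached so far. For
  \<open>v = id\<close> this says that the word is reduced.\<close>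
fun ascending :: "(nat \<Rightarrow> nat) \<Rightarrow> nat list \<Rightarrow> bool" where
  "ascending v [] \<longleftrightarrow> True"
| "ascending v (a # as) \<longleftrightarrow> v a < v (Suc a) \<and> ascending (v \<circ> simple_refl a) as"

lemma word_perm_append: "word_perm (as @ bs) = word_perm as \<circ> word_perm bs"
  by (induction as) (simp_all add: comp_assoc)

lemma ascending_append:
  "ascending v (as @ bs) \<longleftrightarrow> ascending v as \<and> ascending (v \<circ> word_perm as) bs"
  by (induction as arbitrary: v) (auto simp: comp_assoc)

lemma simple_refl_comp [simp]: "simple_refl a \<circ> simple_refl a = id"
  by (auto simp: fun_eq_iff)

lemma simple_refl_permutes: "a \<in> {1..<n} \<Longrightarrow> simple_refl a permutes {1..n}"
  unfolding simple_refl_def by (rule permutes_swap_id) auto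

lemma word_perm_permutes: "set as \<subseteq> {1..<n} \<Longrightarrow> word_perm as permutes {1..n}"
proof (induction as)
  case (Cons a as)
  then show ?case unfolding word_perm_simps by (intro permutes_compose simple_refl_permutes) auto
qed (simp add: permutes_id)

lemma inv_simple_refl: "inv (simple_refl a) = simple_refl a"
  by (rule inv_unique_comp) simp_all

lemma word_perm_rev:
  assumes "set as \<subseteq> {1..<n}" shows "word_perm (rev as) = inv (word_perm as)"
  using assms
proof (induction as)
  case (Cons a as)
  have "inv (simple_refl a \<circ> word_perm as) = inv (word_perm as) \<circ> simple_refl a"
    using Cons.prems word_perm_permutes[of as n] simple_refl_permutes[of a n]
    by (subst o_inv_distrib) (auto simp: inv_simple_refl permutes_bij)
  also have "inv (word_perm as) \<circ> simple_refl a = word_perm (rev (a # as))"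
    using Cons by (simp add: word_perm_append)
  finally have "word_perm (rev (a # as)) = inv (word_perm (a # as))" by simp
  then show ?case .
qed (simp add: inv_id)

lemma finite_inversions:
  fixes v :: "nat \<Rightarrow> nat"
  assumes "v permutes {1..n}" shows "finite {(i, j). i < j \<and> v j < v i}"
proof (rule finite_subset)
  show "{(i, j). i < j \<and> v j < v i} \<subseteq> {0..n} \<times> {0..n}"
  proof clarsimp
    fix i j assume ij: "i < j" "v j < v i"
    have "j \<le> n"
    proof (rule ccontr)
      assume "\<not> j \<le> n"
      then have "v j = j" using assms by (intro permutes_not_in[OF assms]) auto
      moreover have "v i \<le> n \<or> v i = i"
        using permutes_in_image[OF assms, of i] permutes_not_in[OF assms, of i] by auto
      ultimately show False using ij \<open>\<not> j \<le> n\<close> by auto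
    qed
    then show "i \<le> n \<and> j \<le> n" using ij by simp
  qed
qed simp

text \<open>Exchanging the positions \<open>a\<close> and \<open>a + 1\<close> maps the old inversions to new ones and creates just the
  inversion at \<open>(a, a + 1)\<close>.\<close>
lemma perm_length_ascent:
  assumes v: "v permutes {1..n}" and "v a < v (Suc a)"
  shows "perm_length (v \<circ> simple_refl a) = Suc (perm_length v)"
proof -
  let ?s = "simple_refl a"
  let ?I = "\<lambda>v. {(i, j). i < j \<and> (v :: nat \<Rightarrow> nat) j < v i}"
  have inj: "inj_on (map_prod ?s ?s) A" for A
    by (rule inj_on_inverseI[where g = "map_prod ?s ?s"]) auto
  have "(i, j) \<in> ?I (v \<circ> ?s) \<longleftrightarrow> (i, j) \<in> insert (a, Suc a) (map_prod ?s ?s ` ?I v)" for i j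
  proof -
    have img: "(i, j) \<in> map_prod ?s ?s ` ?I v \<longleftrightarrow> ?s i < ?s j \<and> v (?s j) < v (?s i)"
      by (force intro: image_eqI[of _ _ "(?s i, ?s j)"])
    show ?thesis
    proof (cases "i = a \<and> j = Suc a \<or> i = Suc a \<and> j = a")
      case True then show ?thesis using assms(2) unfolding insert_iff img by auto
    next
      case False
      then have "?s i < ?s j \<longleftrightarrow> i < j" by (auto simp: simple_refl_apply)
      then show ?thesis using False unfolding insert_iff img by auto
    qed
  qed
  then have "?I (v \<circ> ?s) = insert (a, Suc a) (map_prod ?s ?s ` ?I v)" by auto
  moreover have "(a, Suc a) \<notin> map_prod ?s ?s ` ?I v"
  proof
    assume "(a, Suc a) \<in> map_prod ?s ?s ` ?I v"
    then obtain i j where "i < j" "?s i = a" "?s j = Suc a" by auto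
    then show False by (auto simp: simple_refl_apply split: if_splits)
  qed
  ultimately show ?thesis
    using finite_inversions[OF v] unfolding perm_length_def by (simp add: card_image[OF inj])
qed

lemma perm_length_descent:
  assumes v: "v permutes {1..n}" and "a \<in> {1..<n}" and "v (Suc a) < v a"
  shows "Suc (perm_length (v \<circ> simple_refl a)) = perm_length v"
proof -
  have "v \<circ> simple_refl a permutes {1..n}"
    using assms by (intro permutes_compose simple_refl_permutes) auto
  from perm_length_ascent[OF this, of a] assms(3) show ?thesis by (simp add: comp_assoc)
qed

lemma permutes_neq_Suc: "v permutes S \<Longrightarrow> v a \<noteq> v (Suc a)"
  by (metis n_not_Suc_n permutes_inverses(2))

lemma perm_length_inv:
  assumes "v permutes {1..n}" shows "perm_length (inv v) = perm_length v"
proof -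
  let ?f = "\<lambda>(i, j). (v j, v i)"
  have v: "inv v (v i) = i" "v (inv v i) = i" for i
    using permutes_inverses[OF assms] by auto
  have "bij_betw ?f {(i, j). i < j \<and> v j < v i} {(i, j). i < j \<and> inv v j < inv v i}"
    by (rule bij_betwI[where g = "\<lambda>(i, j). (inv v j, inv v i)"]) (auto simp: v)
  then show ?thesis unfolding perm_length_def by (simp add: bij_betw_same_card)
qed

lemma perm_length_id: "perm_length id = 0"
  by (auto simp: perm_length_def card_eq_0_iff)

lemma perm_length_word:
  assumes "set as \<subseteq> {1..<n}" "v permutes {1..n}"
  shows "perm_length (v \<circ> word_perm as) \<le> perm_length v + length as \<and>
    (perm_length (v \<circ> word_perm as) = perm_length v + length as \<longleftrightarrow> ascending v as)"
  using assms
proof (induction as arbitrary: v)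
  case (Cons a as)
  let ?v = "v \<circ> simple_refl a"
  have v': "?v permutes {1..n}"
    using Cons.prems by (intro permutes_compose simple_refl_permutes) auto
  have eq: "v \<circ> word_perm (a # as) = ?v \<circ> word_perm as" by (simp add: comp_assoc)
  have IH: "perm_length (?v \<circ> word_perm as) \<le> perm_length ?v + length as \<and>
    (perm_length (?v \<circ> word_perm as) = perm_length ?v + length as \<longleftrightarrow> ascending ?v as)"
    using Cons.prems by (intro Cons.IH v') auto
  consider (up) "v a < v (Suc a)" | (down) "v (Suc a) < v a"
    using permutes_neq_Suc[OF Cons.prems(2)] by (meson nat_neq_iff)
  then have "perm_length (v \<circ> word_perm (a # as)) \<le> perm_length v + length (a # as) \<and>
    (perm_length (v \<circ> word_perm (a # as)) = perm_length v + length (a # as) \<longleftrightarrow> ascending v (a # as))"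
  proof cases
    case up
    then show ?thesis unfolding eq using perm_length_ascent[OF Cons.prems(2) up] IH by auto
  next
    case down
    then have "Suc (perm_length ?v) = perm_length v"
      using Cons.prems by (intro perm_length_descent[of _ n]) auto
    then show ?thesis unfolding eq using IH down by auto
  qed
  then show ?case .
qed simp

lemmas perm_length_word_eq_iff = conjunct2[OF perm_length_word]

text \<open>Each letter changes the length by one, so the word is as long as its product only if all letters
  lengthen it.\<close>
lemma reduced_word_iff:
  "reduced_word n w as \<longleftrightarrow> set as \<subseteq> {1..<n} \<and> ascending id as \<and> word_perm as = w"
  using perm_length_word_eq_iff[of as n id] by (auto simp: reduced_word_def word_perm_def[symmetric] perm_length_id permutes_id)

text \<open>Reversing a word inverts its product, which has the same length.\<close>
lemma ascending_rev:
  assumes "set as \<subseteq> {1..<n}" shows "ascending id (rev as) \<longleftrightarrow> ascending id as"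
  using assms perm_length_word_eq_iff[of as n id] perm_length_word_eq_iff[of "rev as" n id]
    perm_length_inv[OF word_perm_permutes[OF assms]]
  by (simp add: word_perm_rev[OF assms] permutes_id perm_length_id)

lemma ascending_Cons_left:
  assumes "set (a # as) \<subseteq> {1..<n}" "ascending id (a # as)"
  shows "ascending id as" "inv (word_perm as) a < inv (word_perm as) (Suc a)"
proof -
  have "ascending id (rev as @ [a])" using ascending_rev[of "a # as" n] assms by simp
  then show "ascending id as" "inv (word_perm as) a < inv (word_perm as) (Suc a)"
    using assms(1) ascending_rev[of as n] word_perm_rev[of as n] by (simp_all add: ascending_append)
qed

lemma permutes_ascending_id:
  assumes w: "w permutes {1..n}" and asc: "\<And>a. a \<in> {1..<n} \<Longrightarrow> w a < w (Suc a)"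
  shows "w = id"
proof -
  have ge: "i \<le> w i" if "1 \<le> i" "i \<le> n" for i using that
  proof (induction i rule: dec_induct)
    case base then show ?case using permutes_in_image[OF w, of 1] that by auto
  next
    case (step i) then show ?case using asc[of i] by auto
  qed
  have le: "w i \<le> i" if "1 \<le> i" "i \<le> n" for i using that(2,1)
  proof (induction i rule: inc_induct)
    case base then show ?case using permutes_in_image[OF w, of n] that by auto
  next
    case (step i) then show ?case using asc[of i] by auto
  qed
  show ?thesis
  proof
    fix i show "w i = id i"
      using ge[of i] le[of i] permutes_not_in[OF w, of i] by (cases "i \<in> {1..n}") auto
  qed
qed

lemma reduced_word_exists:
  assumes "w permutes {1..n}" shows "\<exists>as. reduced_word n w as"
  using assms
proof (induction "perm_length w" arbitrary: w rule: less_induct)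
  case less
  show ?case
  proof (cases "\<exists>a\<in>{1..<n}. w (Suc a) < w a")
    case True
    then obtain a where a: "a \<in> {1..<n}" "w (Suc a) < w a" by blast
    have p: "w \<circ> simple_refl a permutes {1..n}"
      using less.prems a by (intro permutes_compose simple_refl_permutes) auto
    with less.hyps[of "w \<circ> simple_refl a"] perm_length_descent[OF less.prems a]
    obtain as where "reduced_word n (w \<circ> simple_refl a) as" by auto
    then have "reduced_word n w (as @ [a])"
      using a by (auto simp: reduced_word_iff word_perm_append ascending_append comp_assoc)
    then show ?thesis ..
  next
    case False
    then have "w = id" using permutes_ascending_id[OF less.prems] permutes_neq_Suc[OF less.prems]
      by (meson nat_neq_iff)
    then have "reduced_word n w []" by (simp add: reduced_word_iff)
    then show ?thesis ..
  qed
qed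

section \<open>The longest permutation\<close>

lemma sort_step_permutes:
  "v permutes {1..n} \<Longrightarrow> a \<in> {1..<n} \<Longrightarrow> sort_step a v permutes {1..n}"
  unfolding sort_step_def by (auto intro!: permutes_compose simple_refl_permutes simp del: One_nat_def)

lemma perm_length_sort_step:
  "v permutes {1..n} \<Longrightarrow> perm_length (sort_step a v) \<le> Suc (perm_length v)"
  using perm_length_ascent[of v n a] by (simp add: sort_step_def)

lemma act_delta_too_long:
  assumes "v permutes {1..n}" "fst ` set L \<subseteq> {1..<n}" "perm_length v + length L < perm_length w"
  shows "act L (\<lambda>u. of_bool (u = w)) v = 0"
  using assms
proof (induction L arbitrary: v)
  case (Cons l L)
  obtain a p q where l: "l = (a, p, q)" by (cases l)
  have "act L (\<lambda>u. of_bool (u = w)) v = 0"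
    using Cons by (intro Cons.IH) auto
  moreover have "act L (\<lambda>u. of_bool (u = w)) (sort_step a v) = 0"
    using Cons.prems perm_length_sort_step[OF Cons.prems(1), of a] l
    by (intro Cons.IH sort_step_permutes) auto
  ultimately show ?case by (simp add: l)
qed auto

text \<open>Each letter adds at most one to the length. If the target is as far above \<open>v\<close> as there are letters,
  only the term that takes \<open>t\<^sub>a\<close> from every factor reaches it.\<close>
lemma act_delta_full:
  assumes "v permutes {1..n}" "fst ` set L \<subseteq> {1..<n}" "ascending v (map fst L)"
  shows "act L (\<lambda>u. of_bool (u = v \<circ> word_perm (map fst L))) v = prod_list (map (snd \<circ> snd) L)"
  using assms
proof (induction L arbitrary: v)
  case (Cons l L)
  obtain a p q where l: "l = (a, p, q)" by (cases l)
  let ?w = "v \<circ> word_perm (map fst (l # L))"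
  have w: "?w = v \<circ> simple_refl a \<circ> word_perm (map fst L)" by (simp add: l comp_assoc)
  have "perm_length ?w = perm_length v + length (l # L)"
    using perm_length_word_eq_iff[of "map fst (l # L)" n v] Cons.prems by auto
  then have "act L (\<lambda>u. of_bool (u = ?w)) v = 0"
    using Cons.prems by (intro act_delta_too_long) auto
  moreover have "act L (\<lambda>u. of_bool (u = ?w)) (v \<circ> simple_refl a) = prod_list (map (snd \<circ> snd) L)"
    unfolding w using Cons.prems l
    by (intro Cons.IH permutes_compose simple_refl_permutes) (auto simp: comp_def)
  ultimately have "act (l # L) (\<lambda>u. of_bool (u = ?w)) v = prod_list (map (snd \<circ> snd) (l # L))"
    using Cons.prems by (simp add: l sort_step_def)
  then show ?case .
qed simp

lemma coeff_at_full:
  assumes "reduced_word n w (map fst L)"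
  shows "coeff_at L w = prod_list (map (snd \<circ> snd) L)"
  using act_delta_full[OF permutes_id, of L n] assms by (auto simp: reduced_word_iff coeff_at_def)

text \<open>The product of the first rows of the reduced word \<open>row_letters (n - 1) 1\<close> in progress: the
  greatest values \<open>n, n - 1, \<dots>\<close> stand in the positions before \<open>i\<close>, and the value \<open>n + 1 - i\<close> has been
  moved down to position \<open>b\<close> past the remaining values, which are increasing.\<close>
definition partly_reversed :: "nat \<Rightarrow> nat \<Rightarrow> nat \<Rightarrow> nat \<Rightarrow> nat" where
  "partly_reversed n i b k =
     (if k = 0 \<or> n < k then k else if k < i then n + 1 - k else if k < b then k + 1 - i
      else if k = b then n + 1 - i else k - i)"

lemma partly_reversed_row:
  assumes "1 \<le> i" "i \<le> b" "b \<le> n"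
  shows "ascending (partly_reversed n i n) (rev [b..<n]) \<and>
    partly_reversed n i n \<circ> word_perm (rev [b..<n]) = partly_reversed n i b"
  using assms(3,2)
proof (induction b rule: inc_induct)
  case (step b)
  have "partly_reversed n i (Suc b) b < partly_reversed n i (Suc b) (Suc b)"
    using assms(1) step by (auto simp: partly_reversed_def)
  moreover have "partly_reversed n i (Suc b) \<circ> simple_refl b = partly_reversed n i b"
    using assms(1) step by (auto simp: partly_reversed_def simple_refl_apply fun_eq_iff)
  moreover have "ascending (partly_reversed n i n) (rev [Suc b..<n])"
    and "partly_reversed n i n \<circ> word_perm (rev [Suc b..<n]) = partly_reversed n i (Suc b)"
    using step by (simp_all add: comp_def)
  ultimately have "ascending (partly_reversed n i n) (rev [b..<n]) \<and>
    partly_reversed n i n \<circ> word_perm (rev [b..<n]) = partly_reversed n i b"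
    using step.hyps by (simp add: upt_conv_Cons ascending_append word_perm_append flip: comp_assoc)
  then show ?case .
qed simp

fun row_letters :: "nat \<Rightarrow> nat \<Rightarrow> nat list" where
  "row_letters 0 i = []"
| "row_letters (Suc d) i = rev [i..<i + Suc d] @ row_letters d (Suc i)"

lemma partly_reversed_rows:
  assumes "1 \<le> i"
  shows "ascending (partly_reversed (i + d) i (i + d)) (row_letters d i) \<and>
    partly_reversed (i + d) i (i + d) \<circ> word_perm (row_letters d i) = partly_reversed (i + d) (i + d) (i + d)"
  using assms
proof (induction d arbitrary: i)
  case (Suc d)
  let ?n = "i + Suc d"
  have "partly_reversed ?n i i = partly_reversed ?n (Suc i) ?n"
    using Suc.prems by (auto simp: partly_reversed_def fun_eq_iff)
  then have "ascending (partly_reversed ?n i ?n) (rev [i..<?n])"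
    "partly_reversed ?n i ?n \<circ> word_perm (rev [i..<?n]) = partly_reversed ?n (Suc i) ?n"
    using partly_reversed_row[of i i ?n] Suc.prems by auto
  moreover have "ascending (partly_reversed ?n (Suc i) ?n) (row_letters d (Suc i)) \<and>
      partly_reversed ?n (Suc i) ?n \<circ> word_perm (row_letters d (Suc i)) = partly_reversed ?n ?n ?n"
    using Suc.IH[of "Suc i"] by (simp add: comp_def)
  ultimately have "ascending (partly_reversed ?n i ?n) (row_letters (Suc d) i) \<and>
      partly_reversed ?n i ?n \<circ> word_perm (row_letters (Suc d) i) = partly_reversed ?n ?n ?n"
    by (simp add: ascending_append word_perm_append flip: comp_assoc del: upt_Suc)
  then show ?case .
qed simp

lemma set_row_letters: "set (row_letters d i) \<subseteq> {i..<i + d}"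
  by (induction d arbitrary: i) fastforce+

lemma reduced_word_longest: "reduced_word n (longest_perm n) (row_letters (n - 1) 1)"
proof (cases n)
  case 0 then show ?thesis by (auto simp: reduced_word_iff longest_perm_def fun_eq_iff)
next
  case (Suc m)
  have "partly_reversed n 1 n = id" by (auto simp: partly_reversed_def fun_eq_iff)
  moreover have "partly_reversed n n n = longest_perm n"
    by (auto simp: partly_reversed_def longest_perm_def fun_eq_iff)
  ultimately show ?thesis
    using partly_reversed_rows[of 1 "n - 1"] set_row_letters[of "n - 1" 1] Suc
    by (auto simp: reduced_word_iff)
qed

lemma fst_mixed_row: "map fst (mixed_row d i x y) = rev [i..<i + d]"
  by (induction d arbitrary: i y) (simp_all add: upt_conv_Cons del: upt_Suc)

lemma fst_mixed_rows: "map fst (mixed_rows d i x y) = row_letters d i"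
  by (induction d arbitrary: i) (simp_all add: fst_mixed_row del: mixed_row.simps upt_Suc)

lemma prod_mixed_row: "prod_list (map (snd \<circ> snd) (mixed_row d i x y)) = (\<Prod>j = 1..d. x \<oplus> y j)"
proof (induction d arbitrary: i y)
  case (Suc d)
  then show ?case
    by (subst prod.atLeast_Suc_atMost) (simp_all add: prod.shift_bounds_cl_Suc_ivl mult.commute comp_def del: prod.cl_ivl_Suc)
qed simp

lemma prod_mixed_rows:
  "prod_list (map (snd \<circ> snd) (mixed_rows d i x y)) = (\<Prod>k = i..<i + d. \<Prod>j = 1..i + d - k. x k \<oplus> y j)"
proof (induction d arbitrary: i)
  case (Suc d)
  have "prod_list (map (snd \<circ> snd) (mixed_rows (Suc d) i x y)) =
      (\<Prod>j = 1..Suc d. x i \<oplus> y j) * (\<Prod>k = Suc i..<i + Suc d. \<Prod>j = 1..i + Suc d - k. x k \<oplus> y j)"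
    using Suc[of "Suc i"] prod_mixed_row[of "Suc d" i "x i" y]
    by (simp add: comp_def del: mixed_row.simps prod.cl_ivl_Suc prod.op_ivl_Suc)
  then show ?case by (subst prod.atLeast_Suc_lessThan) simp_all
qed simp

lemma H_longest_eq: "H_longest n = coeff_at (double_word n) (longest_perm n)"
proof -
  have "double_word n \<approx> mixed_rows (n - 1) 1 X Y"
    unfolding double_word_def by (rule staircase_absorb_rows)
  then have "coeff_at (double_word n) (longest_perm n) = coeff_at (mixed_rows (n - 1) 1 X Y) (longest_perm n)"
    by (simp add: equiv_words_def coeff_at_def)
  also have "\<dots> = prod_list (map (snd \<circ> snd) (mixed_rows (n - 1) 1 X Y))"
    by (rule coeff_at_full[of n]) (simp only: fst_mixed_rows reduced_word_longest)
  also have "\<dots> = (\<Prod>i = 1..<n. \<Prod>j = 1..n - i. X i \<oplus> Y j)"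
    by (cases n) (simp_all add: prod_mixed_rows)
  also have "\<dots> = (\<Prod>(i, j)\<in>(SIGMA i:{1..<n}. {1..n - i}). X i \<oplus> Y j)"
    by (rule prod.Sigma) auto
  also have "(SIGMA i:{1..<n}. {1..n - i}) = {(i, j). 1 \<le> i \<and> 1 \<le> j \<and> i + j \<le> n}" by auto
  finally show ?thesis by (simp add: H_longest_def)
qed

lemma longest_perm_involution: "longest_perm n \<circ> longest_perm n = id"
  by (auto simp: longest_perm_def fun_eq_iff)

lemma longest_perm_permutes: "longest_perm n permutes {1..n}"
  by (rule bij_imp_permutes)
     (auto simp: longest_perm_def intro!: bij_betwI[where g = "longest_perm n"])

text \<open>Removing the first letter \<open>a\<close> of a reduced word of \<open>w\<^sup>-\<^sup>1 \<omega>\<^sub>0\<close> gives one of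
  \<open>(w s\<^sub>a)\<^sup>-\<^sup>1 \<omega>\<^sub>0\<close>, and \<open>w s\<^sub>a\<close> is longer than \<open>w\<close> since \<open>\<omega>\<^sub>0\<close> reverses the order.\<close>
lemma mu_word_double_word:
  assumes "w permutes {1..n}" "reduced_word n (inv w \<circ> longest_perm n) as"
  shows "foldr mu_op as (coeff_at (double_word n) (longest_perm n)) = coeff_at (double_word n) w"
  using assms
proof (induction as arbitrary: w)
  case Nil
  have w: "w \<circ> inv w = id" using permutes_inv_o[OF Nil.prems(1)] by simp
  have "inv w \<circ> longest_perm n = id" using Nil.prems unfolding reduced_word_iff by (metis word_perm_simps(1))
  then have "w \<circ> (inv w \<circ> longest_perm n) = w" by simp
  then have "longest_perm n = w" by (simp add: w flip: comp_assoc)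
  then show ?case by simp
next
  case (Cons a as)
  let ?w = "w \<circ> simple_refl a" and ?m = "longest_perm n"
  have as: "set (a # as) \<subseteq> {1..<n}" "ascending id (a # as)"
    and eq: "simple_refl a \<circ> word_perm as = inv w \<circ> ?m"
    using Cons.prems(2) by (simp_all add: reduced_word_iff comp_def)
  have a: "a \<in> {1..<n}" using as by simp
  have w': "?w permutes {1..n}"
    using Cons.prems(1) a by (intro permutes_compose simple_refl_permutes) auto
  have "inv ?w = simple_refl a \<circ> inv w"
    using Cons.prems(1) simple_refl_permutes[OF a]
    by (subst o_inv_distrib) (auto simp: inv_simple_refl permutes_bij)
  then have u: "word_perm as = inv ?w \<circ> ?m"
    using arg_cong[OF eq, of "\<lambda>u. simple_refl a \<circ> u"] by (simp flip: comp_assoc)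
  have IH: "foldr mu_op as (coeff_at (double_word n) ?m) = coeff_at (double_word n) ?w"
  proof (rule Cons.IH[OF w'])
    show "reduced_word n (inv ?w \<circ> ?m) as"
      using as u ascending_Cons_left(1)[OF as] by (simp add: reduced_word_iff)
  qed
  have "inv ?m = ?m" using longest_perm_involution by (rule inv_unique_comp[OF _ longest_perm_involution])
  then have "inv (word_perm as) = ?m \<circ> ?w"
    unfolding u using permutes_bij[OF permutes_inv[OF w']] permutes_bij[OF longest_perm_permutes]
    by (simp add: o_inv_distrib permutes_inv_inv[OF w'])
  then have "?m (?w a) < ?m (?w (Suc a))" using ascending_Cons_left(2)[OF as] by simp
  moreover have "?w a \<in> {1..n}" "?w (Suc a) \<in> {1..n}"
    using a by (simp_all only: permutes_in_image[OF w']) auto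
  ultimately have "?w (Suc a) < ?w a" by (auto simp: longest_perm_def)
  then have "mu_op a (coeff_at (double_word n) ?w) = coeff_at (double_word n) (?w \<circ> simple_refl a)"
    using a by (intro mu_op_double_word) auto
  then show ?case by (simp add: IH comp_assoc)
qed

theorem double_H_eq_coeff:
  assumes "w permutes {1..n}" shows "double_H n w = coeff_at (double_word n) w"
proof -
  have "inv w \<circ> longest_perm n permutes {1..n}"
    using assms by (intro permutes_compose longest_perm_permutes permutes_inv)
  from someI_ex[OF reduced_word_exists[OF this]] show ?thesis
    unfolding double_H_def mu_perm_def H_longest_eq by (intro mu_word_double_word assms)
qed

section \<open>Contracting subwords to reduced ones\<close>

definition subword :: "('p \<Rightarrow> nat) \<Rightarrow> 'p set \<Rightarrow> 'p list \<Rightarrow> nat list" where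
  "subword f D ps = map f (filter (\<lambda>p. p \<in> D) ps)"

lemma subword_simps [simp]:
  "subword f D [] = []"
  "subword f D (p # ps) = (if p \<in> D then f p # subword f D ps else subword f D ps)"
  "subword f D (ps @ qs) = subword f D ps @ subword f D qs"
  "subword f D (rev ps) = rev (subword f D ps)"
  by (simp_all add: subword_def rev_filter rev_map)

lemma subword_insert: "p \<notin> set ps \<Longrightarrow> subword f (insert p D) ps = subword f D ps"
  unfolding subword_def by (rule arg_cong[of _ _ "map f"], rule filter_cong) auto

text \<open>The positions outside \<open>D\<close> whose letter would not lengthen the product of \<open>v\<close> with the letters of
  \<open>D\<close> on its left.\<close>
definition absorbed :: "('p \<Rightarrow> nat) \<Rightarrow> (nat \<Rightarrow> nat) \<Rightarrow> 'p list \<Rightarrow> 'p set \<Rightarrow> 'p set" where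
  "absorbed f v ps D = {p. p \<notin> D \<and> (\<exists>qs rs. ps = qs @ p # rs \<and>
     (v \<circ> word_perm (subword f D qs)) (Suc (f p)) < (v \<circ> word_perm (subword f D qs)) (f p))}"

lemma absorbed_Nil [simp]: "absorbed f v [] D = {}"
  by (simp add: absorbed_def)

lemma absorbed_Cons:
  "absorbed f v (p # ps) D =
    (if p \<in> D then absorbed f (v \<circ> simple_refl (f p)) ps D
     else (if v (Suc (f p)) < v (f p) then {p} else {}) \<union> absorbed f v ps D)"
proof -
  have split: "(\<exists>qs rs. p # ps = qs @ q # rs \<and> P qs) \<longleftrightarrow>
      p = q \<and> P [] \<or> (\<exists>qs rs. ps = qs @ q # rs \<and> P (p # qs))" for q P
    by (auto simp: Cons_eq_append_conv)
  have "q \<in> absorbed f v (p # ps) D \<longleftrightarrow> q \<in> (if p \<in> D then absorbed f (v \<circ> simple_refl (f p)) ps D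
     else (if v (Suc (f p)) < v (f p) then {p} else {}) \<union> absorbed f v ps D)" for q
    unfolding absorbed_def mem_Collect_eq split by auto
  then show ?thesis by blast
qed

lemma absorbed_subset: "absorbed f v ps D \<subseteq> set ps - D"
  by (auto simp: absorbed_def)

lemma absorbed_insert: "p \<notin> set ps \<Longrightarrow> absorbed f v ps (insert p D) = absorbed f v ps D"
  by (induction ps arbitrary: v) (auto simp: absorbed_Cons)

definition ascending_subsets :: "('p \<Rightarrow> nat) \<Rightarrow> (nat \<Rightarrow> nat) \<Rightarrow> 'p list \<Rightarrow> (nat \<Rightarrow> nat) \<Rightarrow> 'p set set" where
  "ascending_subsets f v ps w =
     {D. D \<subseteq> set ps \<and> ascending v (subword f D ps) \<and> v \<circ> word_perm (subword f D ps) = w}"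

lemma finite_ascending_subsets: "finite (ascending_subsets f v ps w)"
  by (rule finite_subset[of _ "Pow (set ps)"]) (auto simp: ascending_subsets_def)

lemma ascending_subsets_Cons:
  assumes "p \<notin> set ps"
  shows "ascending_subsets f v (p # ps) w = ascending_subsets f v ps w \<union>
    (if v (f p) < v (Suc (f p)) then insert p ` ascending_subsets f (v \<circ> simple_refl (f p)) ps w else {})"
    (is "?L = ?R")
proof (intro set_eqI iffI)
  fix D assume D: "D \<in> ?L"
  show "D \<in> ?R"
  proof (cases "p \<in> D")
    case True
    then have eq: "D = insert p (D - {p})" by blast
    have "subword f D ps = subword f (D - {p}) ps"
      using subword_insert[OF assms, of f "D - {p}"] eq by simp
    then have "D - {p} \<in> ascending_subsets f (v \<circ> simple_refl (f p)) ps w"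
      using D True by (auto simp: ascending_subsets_def comp_assoc)
    then have "D \<in> insert p ` ascending_subsets f (v \<circ> simple_refl (f p)) ps w" using eq by blast
    moreover have "v (f p) < v (Suc (f p))" using D True by (simp add: ascending_subsets_def)
    ultimately show ?thesis by simp
  next
    case False
    then show ?thesis using D by (auto simp: ascending_subsets_def)
  qed
next
  fix D assume D: "D \<in> ?R"
  consider "D \<in> ascending_subsets f v ps w" |
    E where "v (f p) < v (Suc (f p))" "D = insert p E" "E \<in> ascending_subsets f (v \<circ> simple_refl (f p)) ps w"
    using D by (auto split: if_splits)
  then show "D \<in> ?L"
  proof cases
    case 1
    then have "p \<notin> D" using assms by (auto simp: ascending_subsets_def)
    then show ?thesis using 1 by (auto simp: ascending_subsets_def)
  next
    case 2
    then show ?thesis using assms by (auto simp: ascending_subsets_def subword_insert comp_assoc)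
  qed
qed

text \<open>Induction on the word, with the permutation \<open>v\<close> reached so far as a parameter. If the first letter
  lengthens \<open>v\<close>, taking it or leaving it gives the two kinds of sets. If it does not, both terms of
  its factor lead back to \<open>v\<close>, so that the factor becomes \<open>1\<close>: the position is absorbed.\<close>
lemma act_delta_subwords:
  fixes x :: "'p \<Rightarrow> 'r::comm_ring_1"
  assumes "distinct ps" "f ` set ps \<subseteq> {1..<n}" "v permutes {1..n}"
  shows "act (map (\<lambda>p. hecke (f p) (x p)) ps) (\<lambda>u. of_bool (u = w)) v =
    (\<Sum>D\<in>ascending_subsets f v ps w. (\<Prod>p\<in>D. x p) * (\<Prod>p\<in>set ps - (D \<union> absorbed f v ps D). 1 - x p))"
  using assms
proof (induction ps arbitrary: v)
  case Nil
  show ?case by (auto simp: ascending_subsets_def)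
next
  case (Cons p ps)
  let ?a = "f p" and ?v = "v \<circ> simple_refl (f p)"
  let ?A = "ascending_subsets f" and ?W = "act (map (\<lambda>p. hecke (f p) (x p)) ps) (\<lambda>u. of_bool (u = w))"
  let ?T = "\<lambda>v ps D. (\<Prod>p\<in>D. x p) * (\<Prod>p\<in>set ps - (D \<union> absorbed f v ps D). 1 - x p)"
  have p: "p \<notin> set ps" using Cons.prems by simp
  have v': "?v permutes {1..n}"
    using Cons.prems by (intro permutes_compose simple_refl_permutes) auto
  have IH: "?W v = sum (?T v ps) (?A v ps w)" "?W ?v = sum (?T ?v ps) (?A ?v ps w)"
    using Cons.prems by (intro Cons.IH v'; simp)+
  have sub: "D \<subseteq> set ps" if "D \<in> ?A u ps w" for D u
    using that by (simp add: ascending_subsets_def)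
  have skip: "?T v (p # ps) D = (if v ?a < v (Suc ?a) then 1 - x p else 1) * ?T v ps D"
    if D: "D \<in> ?A v ps w" for D
  proof -
    have pD: "p \<notin> D" "p \<notin> absorbed f v ps D"
      using sub[OF D] p absorbed_subset[of f v ps D] by auto
    have "v ?a < v (Suc ?a) \<longleftrightarrow> \<not> v (Suc ?a) < v ?a"
      using permutes_neq_Suc[OF Cons.prems(3), of ?a] by auto
    moreover have "set (p # ps) - (D \<union> ({p} \<union> absorbed f v ps D)) = set ps - (D \<union> absorbed f v ps D)"
      using p by auto
    moreover have "set (p # ps) - (D \<union> absorbed f v ps D) = insert p (set ps - (D \<union> absorbed f v ps D))"
      using pD by auto
    ultimately show ?thesis using pD p by (simp add: absorbed_Cons mult_ac)
  qed
  have take: "?T v (p # ps) (insert p D) = x p * ?T ?v ps D" if D: "D \<in> ?A ?v ps w" for D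
  proof -
    have "p \<notin> D" "finite D" using sub[OF D] p by (auto intro: finite_subset)
    moreover have "set (p # ps) - (insert p D \<union> absorbed f ?v ps D) = set ps - (D \<union> absorbed f ?v ps D)"
      using p by auto
    ultimately show ?thesis using p by (simp add: absorbed_Cons absorbed_insert mult_ac)
  qed
  have Skip: "sum (?T v (p # ps)) (?A v ps w) = (if v ?a < v (Suc ?a) then 1 - x p else 1) * ?W v"
    unfolding IH sum_distrib_left by (rule sum.cong) (simp_all only: skip)
  have inj: "inj_on (insert p) (?A ?v ps w)"
    by (rule inj_onI) (metis Diff_insert_absorb p sub subsetD insert_ident)
  have Take: "sum (?T v (p # ps)) (insert p ` ?A ?v ps w) = x p * ?W ?v"
    unfolding IH sum_distrib_left sum.reindex[OF inj] by (rule sum.cong) (simp_all only: take comp_apply)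
  have "act (map (\<lambda>p. hecke (f p) (x p)) (p # ps)) (\<lambda>u. of_bool (u = w)) v = sum (?T v (p # ps)) (?A v (p # ps) w)"
  proof (cases "v ?a < v (Suc ?a)")
    case True
    have "?A v ps w \<inter> insert p ` ?A ?v ps w = {}" using sub p by blast
    then have "sum (?T v (p # ps)) (?A v (p # ps) w) = (1 - x p) * ?W v + x p * ?W ?v"
      using True finite_ascending_subsets[of f]
      by (simp only: ascending_subsets_Cons[OF p] if_True sum.union_disjoint finite_imageI Skip Take)
    then show ?thesis using True by (simp add: sort_step_def)
  next
    case False
    then have "sum (?T v (p # ps)) (?A v (p # ps) w) = ?W v"
      by (simp only: ascending_subsets_Cons[OF p] if_False Un_empty_right Skip mult_1)
    then show ?thesis using False by (simp add: sort_step_def algebra_simps)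
  qed
  then show ?case .
qed

section \<open>Reversing a word\<close>

text \<open>Left multiplication by \<open>t\<^sub>a\<close> in the 0-Hecke monoid. Associativity of the monoid is the fact that it
  commutes with \<open>sort_step\<close>.\<close>
definition left_step :: "nat \<Rightarrow> (nat \<Rightarrow> nat) \<Rightarrow> nat \<Rightarrow> nat" where
  "left_step a w = inv (sort_step a (inv w))"

lemma left_step_eq:
  assumes "w permutes {1..n}" "a \<in> {1..<n}"
  shows "left_step a w = (if inv w a < inv w (Suc a) then simple_refl a \<circ> w else w)"
proof -
  have "inv (inv w \<circ> simple_refl a) = simple_refl a \<circ> w"
    using permutes_bij[OF permutes_inv[OF assms(1)]] permutes_bij[OF simple_refl_permutes[OF assms(2)]]
    by (simp add: o_inv_distrib inv_simple_refl permutes_inv_inv[OF assms(1)])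
  then show ?thesis using permutes_inv_inv[OF assms(1)] by (simp add: left_step_def sort_step_def)
qed

lemma simple_refl_less_iff:
  assumes "{i, j} \<noteq> {a, Suc a}" shows "simple_refl a i < simple_refl a j \<longleftrightarrow> i < j"
  using assms by (auto simp: simple_refl_apply doubleton_eq_iff)

text \<open>The two steps exchange two values and two positions. They interfere only if the values \<open>a, a + 1\<close>
  stand in the positions \<open>b, b + 1\<close>, and then they are the same step.\<close>
lemma left_step_sort_step:
  assumes w: "w permutes {1..n}" and ab: "a \<in> {1..<n}" "b \<in> {1..<n}"
  shows "left_step a (sort_step b w) = sort_step b (left_step a w)"
proof -
  have wi: "inv w (w k) = k" "w (inv w k) = k" for k using permutes_inverses[OF w] by auto
  have inj: "w i = w j \<longleftrightarrow> i = j" for i j by (metis wi(1))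
  have inv_wb: "inv (w \<circ> simple_refl b) = simple_refl b \<circ> inv w"
    using permutes_bij[OF w] permutes_bij[OF simple_refl_permutes[OF ab(2)]]
    by (simp add: o_inv_distrib inv_simple_refl)
  have wb: "w \<circ> simple_refl b permutes {1..n}"
    using w ab by (intro permutes_compose simple_refl_permutes)
  note L = left_step_eq[OF w ab(1)] left_step_eq[OF wb ab(1), unfolded inv_wb]
  show ?thesis
  proof (cases "{w b, w (Suc b)} = {a, Suc a}")
    case True
    have same: "simple_refl a \<circ> w = w \<circ> simple_refl b"
    proof
      fix k
      have "w k \<noteq> a \<and> w k \<noteq> Suc a" if "k \<noteq> b" "k \<noteq> Suc b"
        using True inj[of k b] inj[of k "Suc b"] that by (auto simp: doubleton_eq_iff)
      then show "(simple_refl a \<circ> w) k = (w \<circ> simple_refl b) k"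
        using True by (auto simp: simple_refl_apply doubleton_eq_iff)
    qed
    from True consider "w b = a" "w (Suc b) = Suc a" | "w b = Suc a" "w (Suc b) = a"
      by (auto simp: doubleton_eq_iff)
    then show ?thesis
    proof cases
      case 1
      then have "inv w a = b" "inv w (Suc a) = Suc b" using wi(1) by metis+
      then show ?thesis using 1 same by (simp add: sort_step_def L)
    next
      case 2
      then have "inv w a = Suc b" "inv w (Suc a) = b" using wi(1) by metis+
      then show ?thesis using 2 by (simp add: sort_step_def L)
    qed
  next
    case False
    have False': "{inv w a, inv w (Suc a)} \<noteq> {b, Suc b}"
    proof
      assume "{inv w a, inv w (Suc a)} = {b, Suc b}"
      then have "w ` {inv w a, inv w (Suc a)} = w ` {b, Suc b}" by simp
      then show False using False wi by simp
    qed
    show ?thesis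
      using simple_refl_less_iff[OF False] simple_refl_less_iff[OF False']
      by (simp add: sort_step_def L comp_assoc)
  qed
qed

lemma act_cong:
  assumes "\<And>u. u permutes {1..n} \<Longrightarrow> \<phi> u = \<psi> u" "v permutes {1..n}" "fst ` set L \<subseteq> {1..<n}"
  shows "act L \<phi> v = act L \<psi> v"
  using assms(2,3)
proof (induction L arbitrary: v)
  case (Cons l L)
  then show ?case using sort_step_permutes[of v n "fst l"] by (cases l) auto
qed (simp add: assms(1))

lemma act_left_step:
  assumes "v permutes {1..n}" "fst ` set L \<subseteq> {1..<n}" "a \<in> {1..<n}"
  shows "act L (\<lambda>u. \<phi> (left_step a u)) v = act L \<phi> (left_step a v)"
  using assms(1,2)
proof (induction L arbitrary: v)
  case (Cons l L)
  then show ?case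
    using sort_step_permutes[of v n "fst l"] left_step_sort_step[of v n a "fst l"] assms(3)
    by (cases l) auto
qed simp

text \<open>By associativity the first letter of a product may be applied from the left at the end, and inversion
  turns left into right multiplication.\<close>
lemma act_rev:
  assumes "fst ` set L \<subseteq> {1..<n}"
  shows "act (rev L) (\<lambda>u. \<phi> (inv u)) id = act L \<phi> id"
  using assms
proof (induction L arbitrary: \<phi>)
  case (Cons l L)
  obtain a p q where l: "l = (a, p, q)" by (cases l)
  have a: "a \<in> {1..<n}" and L: "fst ` set L \<subseteq> {1..<n}" using Cons.prems l by auto
  have IH: "act (rev L) (\<lambda>u. \<psi> (inv u)) id = act L \<psi> id" for \<psi>
    by (rule Cons.IH[OF L])
  have "act (rev (l # L)) (\<lambda>u. \<phi> (inv u)) id = act (rev L) (act [l] (\<lambda>u. \<phi> (inv u))) id"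
    by (simp add: act_append)
  also have "\<dots> = act (rev L) (\<lambda>u. p * \<phi> (inv u) + q * \<phi> (left_step a (inv u))) id"
    by (rule act_cong[of n]) (use L in \<open>auto simp: l left_step_def permutes_inv_inv permutes_id\<close>)
  also have "\<dots> = p * act L \<phi> id + q * act L (\<lambda>u. \<phi> (left_step a u)) id"
    unfolding act_linear using IH[of \<phi>] IH[of "\<lambda>u. \<phi> (left_step a u)"] by (simp only:)
  also have "act L (\<lambda>u. \<phi> (left_step a u)) id = act L \<phi> (left_step a id)"
    by (rule act_left_step[OF permutes_id L a])
  also have "left_step a id = sort_step a id"
    unfolding left_step_eq[OF permutes_id a] by (simp add: sort_step_def)
  also have "p * act L \<phi> id + q * act L \<phi> (sort_step a id) = act (l # L) \<phi> id"
    by (simp only: l act.simps)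
  finally show ?case .
qed simp

lemma coeff_at_rev:
  assumes "fst ` set L \<subseteq> {1..<n}" "w permutes {1..n}"
  shows "coeff_at (rev L) (inv w) = coeff_at L w"
proof -
  have "coeff_at (rev L) (inv w) = act (rev L) (\<lambda>u. of_bool (inv u = w)) id"
    unfolding coeff_at_def
  proof (rule act_cong[of n])
    show "of_bool (u = inv w) = of_bool (inv u = w)" if "u permutes {1..n}" for u
    proof -
      have "u = inv w \<longleftrightarrow> inv u = w" using permutes_inv_inv[OF that] permutes_inv_inv[OF assms(2)] by auto
      then show ?thesis by simp
    qed
  qed (use assms in \<open>auto simp: permutes_id\<close>)
  also have "\<dots> = coeff_at L w" unfolding coeff_at_def by (rule act_rev[OF assms(1)])
  finally show ?thesis .
qed

section \<open>Inversions are crossings\<close>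

text \<open>Read \<open>as\<close> from its end as a wiring diagram in which \<open>b\<close> exchanges the wires \<open>b\<close> and \<open>b + 1\<close>.
  Only a crossing changes the order of two wires, and in a reduced word two wires that are already
  inverted cannot cross back, because every letter lengthens the product of the letters after it.\<close>
lemma inversion_iff_crossing:
  assumes "set as \<subseteq> {1..<n}" "ascending id as" "c < d"
  shows "word_perm as d < word_perm as c \<longleftrightarrow>
    (\<exists>bs b cs. as = bs @ b # cs \<and> {word_perm cs c, word_perm cs d} = {b, Suc b})"
  using assms(1,2)
proof (induction as)
  case Nil
  then show ?case using assms(3) by simp
next
  case (Cons a as)
  let ?w = "word_perm as"
  let ?cross = "\<lambda>as. \<exists>bs b cs. as = bs @ b # cs \<and> {word_perm cs c, word_perm cs d} = {b, Suc b}"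
  have w: "?w permutes {1..n}" using Cons.prems by (intro word_perm_permutes) auto
  have asc: "ascending id as" "inv ?w a < inv ?w (Suc a)" using ascending_Cons_left[OF Cons.prems] .
  have "?w d < ?w c \<longleftrightarrow> ?cross as" by (rule Cons.IH[OF _ asc(1)]) (use Cons.prems in auto)
  moreover have "?cross (a # as) \<longleftrightarrow> {?w c, ?w d} = {a, Suc a} \<or> ?cross as"
    by (auto simp: Cons_eq_append_conv)
  moreover have "simple_refl a (?w d) < simple_refl a (?w c) \<longleftrightarrow> {?w c, ?w d} = {a, Suc a} \<or> ?w d < ?w c"
  proof (cases "{?w c, ?w d} = {a, Suc a}")
    case True
    have "\<not> (?w c = Suc a \<and> ?w d = a)"
      using asc(2) assms(3) permutes_inverses(2)[OF w, of c] permutes_inverses(2)[OF w, of d] by auto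
    then have "?w c = a" "?w d = Suc a" using True by (auto simp: doubleton_eq_iff)
    then show ?thesis by simp
  next
    case False
    then have "{?w d, ?w c} \<noteq> {a, Suc a}" by (simp add: insert_commute)
    from simple_refl_less_iff[OF this] False show ?thesis by simp
  qed
  ultimately have "word_perm (a # as) d < word_perm (a # as) c \<longleftrightarrow> ?cross (a # as)"
    by simp
  then show ?case .
qed

section \<open>The reading word of all positions\<close>

text \<open>The boxes \<open>(k, j)\<close> with \<open>k \<ge> i\<close>, \<open>j \<ge> 1\<close> and \<open>k + j \<le> i + d\<close> in the order of rc-graphs: by rows,
  and from right to left within a row. The box of row \<open>i\<close> with letter \<open>a\<close> lies in column
  \<open>a + 1 - i\<close>.\<close>
fun triangle :: "nat \<Rightarrow> nat \<Rightarrow> (nat \<times> nat) list" where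
  "triangle 0 i = []"
| "triangle (Suc d) i = map (\<lambda>a. (i, Suc a - i)) (rev [i..<i + Suc d]) @ triangle d (Suc i)"

lemma distinct_if_sorted_irrefl:
  assumes "sorted_wrt R xs" "\<And>x. \<not> R x x" shows "distinct xs"
  using assms by (induction xs) auto

lemma set_triangle: "set (triangle d i) = {(k, j). i \<le> k \<and> 1 \<le> j \<and> k + j \<le> i + d}"
proof (induction d arbitrary: i)
  case (Suc d)
  have "(\<lambda>a. (i, Suc a - i)) ` {i..<i + Suc d} = {(k, j). k = i \<and> 1 \<le> j \<and> k + j \<le> i + Suc d}"
  proof (intro equalityI subsetI)
    fix p assume "p \<in> {(k, j). k = i \<and> 1 \<le> j \<and> k + j \<le> i + Suc d}"
    then have "p = (\<lambda>a. (i, Suc a - i)) (i + snd p - 1)" "i + snd p - 1 \<in> {i..<i + Suc d}" by auto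
    then show "p \<in> (\<lambda>a. (i, Suc a - i)) ` {i..<i + Suc d}" by blast
  qed auto
  then show ?case using Suc.IH[of "Suc i"] by (auto simp del: upt_Suc)
qed auto

lemma sorted_triangle:
  "sorted_wrt (\<lambda>p q. fst p < fst q \<or> fst p = fst q \<and> snd q < snd p) (triangle d i)"
proof (induction d arbitrary: i)
  case (Suc d)
  have "sorted_wrt (\<lambda>a b. Suc b - i < Suc a - i) (rev [i..<i + Suc d])"
    unfolding sorted_wrt_rev by (rule sorted_wrt_mono_rel[OF _ sorted_wrt_upt]) auto
  then show ?case
    using Suc by (auto simp: sorted_wrt_append sorted_wrt_map set_triangle simp del: upt_Suc)
qed simp

definition row_reading :: "nat \<Rightarrow> (nat \<times> nat) list" where
  "row_reading n = triangle (n - 1) 1"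

lemma set_row_reading: "set (row_reading n) = {(i, j). 1 \<le> i \<and> 1 \<le> j \<and> i + j \<le> n}"
  by (auto simp: row_reading_def set_triangle)

lemma sorted_row_reading:
  "sorted_wrt (\<lambda>p q. fst p < fst q \<or> fst p = fst q \<and> snd q < snd p) (row_reading n)"
  unfolding row_reading_def by (rule sorted_triangle)

abbreviation box_letter :: "nat \<times> nat \<Rightarrow> nat" where
  "box_letter \<equiv> \<lambda>(i, j). i + j - 1"

lemma desc_rows_triangle:
  "desc_rows d i x = map (\<lambda>p. hecke (box_letter p) (x (fst p))) (triangle d i)"
  by (induction d arbitrary: i)
     (auto simp: desc_row_eq simp del: desc_row.simps upt_Suc)

lemma staircase_triangle:
  "staircase d i y = rev (map (\<lambda>p. hecke (box_letter p) (y (Suc (fst p) - i))) (triangle d i))"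
proof (induction d arbitrary: i y)
  case (Suc d)
  have "map (\<lambda>p. hecke (box_letter p) (y (Suc (Suc (fst p) - Suc i)))) (triangle d (Suc i)) =
        map (\<lambda>p. hecke (box_letter p) (y (Suc (fst p) - i))) (triangle d (Suc i))"
    by (auto simp: set_triangle Suc_diff_le)
  then show ?case
    by (simp add: Suc desc_row_eq rev_map comp_def del: desc_row.simps upt_Suc)
qed simp

definition lower_box :: "nat \<times> nat \<Rightarrow> int \<times> nat" where "lower_box = (\<lambda>(i, j). (int i, j))"
definition upper_box :: "nat \<times> nat \<Rightarrow> int \<times> nat" where "upper_box = (\<lambda>(i, j). (- int i, j))"

text \<open>The upper diagram is read in reverse because the permutation is \<open>v\<^sup>-\<^sup>1 u\<close>.\<close>
definition reading :: "nat \<Rightarrow> (int \<times> nat) list" where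
  "reading n = rev (map upper_box (row_reading n)) @ map lower_box (row_reading n)"

definition letter :: "int \<times> nat \<Rightarrow> nat" where
  "letter p = nat \<bar>fst p\<bar> + snd p - 1"

text \<open>The order in which lines run through the positions, which is the reverse of the reading order: rows
  from bottom to top, columns from left to right below and from right to left above. It also covers the
  boundary positions and column \<open>0\<close>, so that it applies to all points of a line.\<close>
definition swept_before :: "int \<times> nat \<Rightarrow> int \<times> nat \<Rightarrow> bool" where
  "swept_before p q \<longleftrightarrow> fst q < fst p \<or>
     fst p = fst q \<and> (if fst p > 0 then snd p < snd q else snd q < snd p)"

lemma letter_box [simp]: "letter (lower_box p) = box_letter p" "letter (upper_box p) = box_letter p"
  by (auto simp: letter_def lower_box_def upper_box_def split: prod.splits)

lemma set_reading: "set (reading n) = positions n"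
proof -
  have "p \<in> positions n \<longleftrightarrow> p \<in> lower_box ` set (row_reading n) \<union> upper_box ` set (row_reading n)" for p
  proof
    assume p: "p \<in> positions n"
    obtain i j where ij: "p = (i, j)" by (cases p)
    have "(nat \<bar>i\<bar>, j) \<in> set (row_reading n)" using p ij by (auto simp: positions_def set_row_reading)
    moreover have "p = lower_box (nat \<bar>i\<bar>, j) \<or> p = upper_box (nat \<bar>i\<bar>, j)"
      using ij by (auto simp: lower_box_def upper_box_def)
    ultimately show "p \<in> lower_box ` set (row_reading n) \<union> upper_box ` set (row_reading n)" by blast
  qed (auto simp: positions_def set_row_reading lower_box_def upper_box_def)
  then show ?thesis by (auto simp: reading_def)
qed

lemma finite_positions: "finite (positions n)"
  unfolding set_reading[symmetric] by simp

lemma sorted_reading: "sorted_wrt (\<lambda>p q. swept_before q p) (reading n)"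
proof -
  have "sorted_wrt (\<lambda>p q. swept_before (lower_box q) (lower_box p)) (row_reading n)"
    "sorted_wrt (\<lambda>p q. swept_before (upper_box p) (upper_box q)) (row_reading n)"
    by (rule sorted_wrt_mono_rel[OF _ sorted_row_reading],
        auto simp: swept_before_def lower_box_def upper_box_def set_row_reading)+
  then show ?thesis
    by (auto simp: reading_def sorted_wrt_append sorted_wrt_map sorted_wrt_rev set_row_reading
        swept_before_def lower_box_def upper_box_def)
qed

lemma swept_before_irrefl: "\<not> swept_before p p" by (simp add: swept_before_def)
lemma swept_before_trans: "swept_before p q \<Longrightarrow> swept_before q r \<Longrightarrow> swept_before p r"
  by (auto simp: swept_before_def split: if_splits)
lemma swept_before_total: "swept_before p q \<or> p = q \<or> swept_before q p"
  by (auto simp: swept_before_def prod_eq_iff)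

lemma distinct_reading: "distinct (reading n)"
  by (rule distinct_if_sorted_irrefl[OF sorted_reading]) (rule swept_before_irrefl)

lemma letter_positions: "p \<in> positions n \<Longrightarrow> letter p \<in> {1..<n}"
  by (auto simp: positions_def letter_def)

lemma double_word_eq: "double_word n = map (\<lambda>p. hecke (letter p) (Var (fst p))) (reading n)"
proof -
  have "staircase (n - 1) 1 Y = rev (map (\<lambda>p. hecke (box_letter p) (Y (fst p))) (row_reading n))"
    unfolding staircase_triangle row_reading_def by simp
  moreover have "map (\<lambda>p. hecke (box_letter p) (Y (fst p))) (row_reading n) =
      map (\<lambda>p. hecke (letter p) (Var (fst p))) (map upper_box (row_reading n))"
    by (auto simp: upper_box_def letter_def)
  moreover have "map (\<lambda>p. hecke (box_letter p) (X (fst p))) (row_reading n) =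
      map (\<lambda>p. hecke (letter p) (Var (fst p))) (map lower_box (row_reading n))"
    by (auto simp: lower_box_def letter_def)
  ultimately show ?thesis
    unfolding double_word_def desc_rows_triangle reading_def row_reading_def[symmetric]
    by (simp only: map_append rev_map)
qed

section \<open>Double rc-graphs as subwords\<close>

lemma rc_le_antisym: "rc_le p q \<Longrightarrow> rc_le q p \<Longrightarrow> p = q"
  by (auto simp: rc_le_def prod_eq_iff)

lemma sorted_rc_le_unique:
  assumes "sorted_wrt rc_le ps" "sorted_wrt rc_le qs" "distinct ps" "distinct qs" "set ps = set qs"
  shows "ps = qs"
  using assms
proof (induction ps arbitrary: qs)
  case (Cons p ps)
  then obtain q qs' where qs: "qs = q # qs'" by (cases qs) auto
  have "p = q"
  proof (rule ccontr)
    assume "p \<noteq> q"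
    then have "q \<in> set ps" "p \<in> set qs'" using Cons.prems(5) qs by auto
    then show False using Cons.prems(1,2) qs \<open>p \<noteq> q\<close> rc_le_antisym by auto
  qed
  moreover have "ps = qs'" using Cons.prems qs \<open>p = q\<close> by (intro Cons.IH) auto
  ultimately show ?case using qs by simp
qed simp

text \<open>The list in the definition of an rc-graph is forced, since \<open>rc_le\<close> is a total order.\<close>
lemma rc_graph_iff:
  "rc_graph n u R \<longleftrightarrow> R \<subseteq> set (row_reading n) \<and> reduced_word n u (subword box_letter R (row_reading n))"
proof -
  let ?ps = "filter (\<lambda>p. p \<in> R) (row_reading n)"
  have sorted: "sorted_wrt rc_le ?ps"
    by (rule sorted_wrt_filter, rule sorted_wrt_mono_rel[OF _ sorted_row_reading]) (auto simp: rc_le_def)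
  have distinct: "distinct ?ps"
    by (rule distinct_filter, rule distinct_if_sorted_irrefl[OF sorted_row_reading]) simp
  have set: "set ?ps = R" if "R \<subseteq> set (row_reading n)" using that by auto
  have uniq: "ps = ?ps" if "R \<subseteq> set (row_reading n)" "set ps = R" "distinct ps" "sorted_wrt rc_le ps" for ps
    by (rule sorted_rc_le_unique[OF that(4) sorted that(3) distinct]) (use that set in simp)
  show ?thesis
    unfolding rc_graph_def set_row_reading[symmetric] subword_def
    using sorted distinct set uniq by (metis (no_types, lifting))
qed

text \<open>If the concatenation is reduced, so are both parts, and the lengths add up; conversely the
  concatenation is as long as its product.\<close>
lemma reduced_word_rev_append:
  assumes "set as \<subseteq> {1..<n}" "set bs \<subseteq> {1..<n}"
  shows "reduced_word n w (rev as @ bs) \<longleftrightarrow>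
    (\<exists>u v. u permutes {1..n} \<and> v permutes {1..n} \<and> inv v \<circ> u = w \<and>
      perm_length w = perm_length u + perm_length v \<and> reduced_word n u bs \<and> reduced_word n v as)"
proof
  assume r: "reduced_word n w (rev as @ bs)"
  then have asc: "ascending id (rev as @ bs)" by (simp add: reduced_word_iff)
  have "ascending id (rev (rev as @ bs))"
    using ascending_rev[of "rev as @ bs" n] asc assms by simp
  then have "ascending id bs" using ascending_rev[OF assms(2)] by (simp add: ascending_append)
  moreover have "ascending id as" using asc ascending_rev[OF assms(1)] by (simp add: ascending_append)
  ultimately have red: "reduced_word n (word_perm bs) bs" "reduced_word n (word_perm as) as"
    using assms by (simp_all add: reduced_word_iff)
  moreover have "inv (word_perm as) \<circ> word_perm bs = w"
    using r assms by (simp add: reduced_word_iff word_perm_append word_perm_rev[OF assms(1)])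
  moreover have "perm_length w = perm_length (word_perm bs) + perm_length (word_perm as)"
    using r red by (simp add: reduced_word_def)
  ultimately show "\<exists>u v. u permutes {1..n} \<and> v permutes {1..n} \<and> inv v \<circ> u = w \<and>
      perm_length w = perm_length u + perm_length v \<and> reduced_word n u bs \<and> reduced_word n v as"
    using word_perm_permutes assms by blast
next
  assume "\<exists>u v. u permutes {1..n} \<and> v permutes {1..n} \<and> inv v \<circ> u = w \<and>
      perm_length w = perm_length u + perm_length v \<and> reduced_word n u bs \<and> reduced_word n v as"
  then obtain u v where uv: "inv v \<circ> u = w" "perm_length w = perm_length u + perm_length v"
    and red: "reduced_word n u bs" "reduced_word n v as" by blast
  have "word_perm (rev as @ bs) = w"
    using uv(1) red assms by (simp add: reduced_word_iff word_perm_append word_perm_rev[OF assms(1)])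
  moreover have "length (rev as @ bs) = perm_length w"
    using uv(2) red by (simp add: reduced_word_def)
  ultimately show "reduced_word n w (rev as @ bs)"
    using assms by (simp add: reduced_word_def word_perm_def)
qed

lemma subword_double_diagram:
  assumes "R \<subseteq> set (row_reading n)" "S \<subseteq> set (row_reading n)"
  shows "subword letter (double_diagram R S) (reading n) =
    rev (subword box_letter S (row_reading n)) @ subword box_letter R (row_reading n)"
proof -
  have D: "double_diagram R S = lower_box ` R \<union> upper_box ` S"
    by (auto simp: double_diagram_def lower_box_def upper_box_def)
  have pos: "1 \<le> fst p" if "p \<in> set (row_reading n)" for p using that by (auto simp: set_row_reading)
  have "lower_box p \<in> double_diagram R S \<longleftrightarrow> p \<in> R" "upper_box p \<in> double_diagram R S \<longleftrightarrow> p \<in> S"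
    if "p \<in> set (row_reading n)" for p
    using pos[OF that] pos assms unfolding D
    by (auto simp: lower_box_def upper_box_def image_iff split: prod.splits)
  then have "subword letter (double_diagram R S) (map lower_box (row_reading n)) = subword box_letter R (row_reading n)"
    "subword letter (double_diagram R S) (map upper_box (row_reading n)) = subword box_letter S (row_reading n)"
    by (simp_all add: subword_def filter_map comp_def cong: filter_cong)
  then show ?thesis by (simp add: reading_def)
qed

lemma double_diagram_exists:
  assumes "D \<subseteq> positions n"
  obtains R S where "R \<subseteq> set (row_reading n)" "S \<subseteq> set (row_reading n)" "D = double_diagram R S"
proof -
  let ?R = "{p \<in> set (row_reading n). lower_box p \<in> D}" and ?S = "{p \<in> set (row_reading n). upper_box p \<in> D}"
  have "D = lower_box ` ?R \<union> upper_box ` ?S"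
    using assms unfolding set_reading[symmetric] reading_def by auto
  also have "\<dots> = double_diagram ?R ?S" by (auto simp: double_diagram_def lower_box_def upper_box_def)
  finally show thesis by (intro that[of ?R ?S]) auto
qed

lemma double_diagram_positions:
  assumes "R \<subseteq> set (row_reading n)" "S \<subseteq> set (row_reading n)"
  shows "double_diagram R S \<subseteq> positions n"
  using assms unfolding set_reading[symmetric] reading_def
  by (auto simp: double_diagram_def lower_box_def upper_box_def)

text \<open>The condition on lengths in the definition of a double rc-graph says that the combined word is
  reduced.\<close>
lemma double_rc_graphs_eq: "double_rc_graphs n w = ascending_subsets letter id (reading n) w"
proof -
  have box: "set (subword box_letter R (row_reading n)) \<subseteq> {1..<n}" for R
    by (auto simp: subword_def set_row_reading)
  have sub: "set (subword letter D (reading n)) \<subseteq> {1..<n}" for D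
    using letter_positions by (fastforce simp: subword_def set_reading)
  have iff: "reduced_word n w (subword letter (double_diagram R S) (reading n)) \<longleftrightarrow>
      (\<exists>u v. u permutes {1..n} \<and> v permutes {1..n} \<and> inv v \<circ> u = w \<and>
        perm_length w = perm_length u + perm_length v \<and> rc_graph n u R \<and> rc_graph n v S)"
    if "R \<subseteq> set (row_reading n)" "S \<subseteq> set (row_reading n)" for R S
    unfolding subword_double_diagram[OF that] reduced_word_rev_append[OF box box] rc_graph_iff
    using that by simp
  have "double_rc_graphs n w = {D. D \<subseteq> positions n \<and> reduced_word n w (subword letter D (reading n))}"
    (is "_ = ?M")
  proof (intro equalityI subsetI)
    fix D assume "D \<in> double_rc_graphs n w"
    then obtain R S u v where D: "D = double_diagram R S" and uv: "u permutes {1..n}" "v permutes {1..n}"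
      "inv v \<circ> u = w" "perm_length w = perm_length u + perm_length v" "rc_graph n u R" "rc_graph n v S"
      unfolding double_rc_graphs_def by blast
    have RS: "R \<subseteq> set (row_reading n)" "S \<subseteq> set (row_reading n)" using uv by (simp_all add: rc_graph_iff)
    then show "D \<in> ?M" using uv iff[OF RS] double_diagram_positions[OF RS] unfolding D by blast
  next
    fix D assume D: "D \<in> ?M"
    then obtain R S where RS: "R \<subseteq> set (row_reading n)" "S \<subseteq> set (row_reading n)" "D = double_diagram R S"
      using double_diagram_exists by blast
    then show "D \<in> double_rc_graphs n w" using D iff[OF RS(1,2)] unfolding double_rc_graphs_def by blast
  qed
  then show ?thesis using sub by (auto simp: ascending_subsets_def reduced_word_iff set_reading)
qed

section \<open>Lines as wires\<close>

text \<open>Line \<open>k\<close> starts on wire \<open>k\<close>, and every position of \<open>D\<close> with letter \<open>a\<close> exchanges the wires \<open>a\<close> and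
  \<open>a + 1\<close> when it is swept. Then \<open>wires_before n D p k\<close> is the wire of line \<open>k\<close> just before \<open>p\<close> is
  swept.\<close>
definition wires_before :: "nat \<Rightarrow> (int \<times> nat) set \<Rightarrow> int \<times> nat \<Rightarrow> nat \<Rightarrow> nat" where
  "wires_before n D p = word_perm (subword letter D (filter (\<lambda>q. swept_before q p) (reading n)))"

lemma filter_split_sorted:
  assumes "sorted_wrt R xs" "\<And>x y. R x y \<Longrightarrow> C x \<Longrightarrow> C y"
  shows "filter A xs = filter (\<lambda>x. A x \<and> \<not> C x) xs @ filter (\<lambda>x. A x \<and> C x) xs"
  using assms(1)
proof (induction xs)
  case (Cons x xs)
  show ?case
  proof (cases "C x")
    case True
    then have "\<forall>y\<in>set xs. C y" using Cons.prems assms(2) by auto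
    then have "filter (\<lambda>x. A x \<and> \<not> C x) xs = []" "filter (\<lambda>x. A x \<and> C x) xs = filter A xs"
      by (auto intro: filter_cong)
    then show ?thesis using True by simp
  next
    case False
    then show ?thesis using Cons by simp
  qed
qed simp

lemma word_perm_untouched:
  "(\<And>a. a \<in> set as \<Longrightarrow> c \<noteq> a \<and> c \<noteq> Suc a) \<Longrightarrow> word_perm as c = c"
proof (induction as)
  case (Cons a as)
  then have "word_perm as c = c" by simp
  moreover have "simple_refl a c = c" using Cons.prems[of a] by (simp add: simple_refl_apply)
  ultimately show ?case by simp
qed simp

text \<open>The word swept before \<open>q\<close> is the word swept before \<open>p\<close>, preceded by the letter of \<open>p\<close> if
  \<open>p \<in> D\<close> and by letters that do not touch the wire \<open>c\<close>. This is applied to consecutive points of a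
  line.\<close>
lemma wires_before_next:
  assumes D: "D \<subseteq> positions n" and pq: "swept_before p q"
    and c: "c = (if p \<in> D then simple_refl (letter p) (wires_before n D p k) else wires_before n D p k)"
    and untouched: "\<And>r. r \<in> positions n \<Longrightarrow> swept_before p r \<Longrightarrow> swept_before r q \<Longrightarrow>
        c \<noteq> letter r \<and> c \<noteq> Suc (letter r)"
  shows "wires_before n D q k = c"
proof -
  let ?P = "reading n"
  let ?B = "\<lambda>r. swept_before r q \<and> \<not> (r = p \<or> swept_before r p)"
  have "filter (\<lambda>r. swept_before r q) ?P = filter ?B ?P @
      filter (\<lambda>r. swept_before r q \<and> (r = p \<or> swept_before r p)) ?P"
    by (rule filter_split_sorted[OF sorted_reading]) (auto intro: swept_before_trans)
  also have "filter (\<lambda>r. swept_before r q \<and> (r = p \<or> swept_before r p)) ?P =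
      filter (\<lambda>r. r = p \<or> swept_before r p) ?P"
    by (rule filter_cong[OF refl]) (use pq swept_before_trans in blast)
  also have "\<dots> = filter (\<lambda>r. (r = p \<or> swept_before r p) \<and> \<not> swept_before r p) ?P @
      filter (\<lambda>r. (r = p \<or> swept_before r p) \<and> swept_before r p) ?P"
    by (rule filter_split_sorted[OF sorted_reading]) (auto intro: swept_before_trans)
  also have "filter (\<lambda>r. (r = p \<or> swept_before r p) \<and> swept_before r p) ?P = filter (\<lambda>r. swept_before r p) ?P"
    by (rule filter_cong) auto
  also have "filter (\<lambda>r. (r = p \<or> swept_before r p) \<and> \<not> swept_before r p) ?P = filter (\<lambda>r. r = p) ?P"
    using swept_before_irrefl by (auto intro!: filter_cong)
  also have "filter (\<lambda>r. r = p) ?P = (if p \<in> positions n then [p] else [])"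
  proof -
    have "filter (\<lambda>r. r = p) xs = (if p \<in> set xs then [p] else [])" if "distinct xs" for xs
      using that by (induction xs) (auto simp: filter_empty_conv)
    then show ?thesis using distinct_reading by (simp add: set_reading)
  qed
  finally have "wires_before n D q k = word_perm (subword letter D (filter ?B ?P)) c"
    using D c unfolding wires_before_def by (auto simp: word_perm_append)
  also have "\<dots> = c"
  proof (rule word_perm_untouched)
    fix a assume "a \<in> set (subword letter D (filter ?B ?P))"
    then obtain r where "a = letter r" "r \<in> positions n" "?B r" by (auto simp: subword_def set_reading)
    then show "c \<noteq> a \<and> c \<noteq> Suc a" using untouched[of r] swept_before_total[of p r] by auto
  qed
  finally show ?thesis .
qed

text \<open>The states of a line inside the diagram. At a boundary position \<open>\<bar>i\<bar> + j = n + 1\<close> only one of the two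
  headings occurs, because the diagram ends there on the other side.\<close>
definition regular_state :: "nat \<Rightarrow> (int \<times> nat) \<times> heading \<Rightarrow> bool" where
  "regular_state n = (\<lambda>((i, j), h). i \<noteq> 0 \<and> 1 \<le> j \<and> \<bar>i\<bar> + int j \<le> int n + 1 \<and>
     (\<bar>i\<bar> + int j = int n + 1 \<longrightarrow> h = (if 0 < i then Across else Upward)))"

text \<open>A line that has left the diagram at the left end of an upper row.\<close>
definition exit_state :: "(int \<times> nat) \<times> heading \<Rightarrow> bool" where
  "exit_state = (\<lambda>((i, j), h). i < 0 \<and> j = 0 \<and> h = Across)"

text \<open>The wire that carries a line arriving in the given state: of the two wires \<open>a\<close> and \<open>a + 1\<close> at a
  position with letter \<open>a\<close>, the line from the left has \<open>a\<close> and the line from below has \<open>a + 1\<close> in the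
  lower diagram; in the upper diagram the line from below has \<open>a\<close> and the line from the right has
  \<open>a + 1\<close>.\<close>
definition wire :: "(int \<times> nat) \<times> heading \<Rightarrow> nat" where
  "wire = (\<lambda>((i, j), h). if (0 < i) = (h = Across) then nat \<bar>i\<bar> + j - 1 else nat \<bar>i\<bar> + j)"

lemma line_step_regular:
  assumes D: "D \<subseteq> positions n" and s: "regular_state n s"
  defines "s' \<equiv> line_step D s"
  shows "swept_before (fst s) (fst s')"
    and "regular_state n s' \<or> exit_state s'"
    and "wire s' = (if fst s \<in> D then simple_refl (letter (fst s)) (wire s) else wire s)"
    and "\<And>r. r \<in> positions n \<Longrightarrow> swept_before (fst s) r \<Longrightarrow> swept_before r (fst s') \<Longrightarrow>
        wire s' \<noteq> letter r \<and> wire s' \<noteq> Suc (letter r)"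
proof -
  obtain i j h where sij: "s = ((i, j), h)" by (metis prod.exhaust)
  have reg: "i \<noteq> 0" "1 \<le> j" "\<bar>i\<bar> + int j \<le> int n + 1"
    "\<bar>i\<bar> + int j = int n + 1 \<longrightarrow> h = (if 0 < i then Across else Upward)"
    using s sij by (auto simp: regular_state_def)
  have inD: "(i, j) \<in> D \<Longrightarrow> \<bar>i\<bar> + int j \<le> int n" using D by (auto simp: positions_def)
  define g where "g = (if (i, j) \<in> D then h else turn h)"
  have s': "s' = advance ((i, j), g)" using reg unfolding s'_def line_step_def sij g_def by auto
  have g: "\<bar>i\<bar> + int j = int n + 1 \<longrightarrow> g = (if 0 < i then Upward else Across)"
    using reg(4) inD unfolding g_def by auto
  show "swept_before (fst s) (fst s')"
    using reg by (cases g) (auto simp: s' sij swept_before_def)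
  show "regular_state n s' \<or> exit_state s'"
    using reg g by (cases g) (auto simp: s' regular_state_def exit_state_def)
  have "wire ((i, j), h) = (if (0 < i) = (h = Across) then letter (i, j) else Suc (letter (i, j)))"
    using reg by (auto simp: wire_def letter_def)
  moreover have "wire s' = (if (0 < i) = (g = Across) then Suc (letter (i, j)) else letter (i, j))"
    using reg by (cases g) (auto simp: s' wire_def letter_def)
  ultimately show "wire s' = (if fst s \<in> D then simple_refl (letter (fst s)) (wire s) else wire s)"
    unfolding sij g_def by (cases h) auto
  fix r assume "r \<in> positions n" "swept_before (fst s) r" "swept_before r (fst s')"
  then show "wire s' \<noteq> letter r \<and> wire s' \<noteq> Suc (letter r)"
    using reg by (cases g; cases r; cases "0 < i"; cases "0 < fst r") (auto simp: s' sij wire_def letter_def swept_before_def positions_def split: if_splits)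
qed

definition line_state :: "(int \<times> nat) set \<Rightarrow> nat \<Rightarrow> nat \<Rightarrow> (int \<times> nat) \<times> heading" where
  "line_state D k t = (line_step D ^^ t) ((int k, 1), Across)"

lemma line_state_simps [simp]:
  "line_state D k 0 = ((int k, 1), Across)"
  "line_state D k (Suc t) = line_step D (line_state D k t)"
  by (simp_all add: line_state_def)

lemma line_position_eq: "line_position D k t = fst (line_state D k t)"
  by (simp add: line_position_def line_state_def)

lemma line_step_exit: "exit_state s \<Longrightarrow> line_step D s = s"
  by (auto simp: exit_state_def line_step_def)

context
  fixes n :: nat and D :: "(int \<times> nat) set" and k :: nat
  assumes D: "D \<subseteq> positions n" and k: "k \<in> {1..n}"
begin

lemma letter_before_start:
  "p \<in> positions n \<Longrightarrow> swept_before p (int k, 1) \<Longrightarrow> k < letter p"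
  using k by (auto simp: positions_def swept_before_def letter_def split: if_splits)

lemma wires_before_start:
  assumes "\<And>r. r \<in> positions n \<Longrightarrow> swept_before r p \<Longrightarrow> swept_before r (int k, 1)"
  shows "wires_before n D p k = k"
  unfolding wires_before_def
proof (rule word_perm_untouched)
  fix a assume "a \<in> set (subword letter D (filter (\<lambda>q. swept_before q p) (reading n)))"
  then obtain r where "a = letter r" "r \<in> positions n" "swept_before r p"
    by (auto simp: subword_def set_reading)
  then show "k \<noteq> a \<and> k \<noteq> Suc a" using letter_before_start[of r] assms[of r] by auto
qed

lemma line_state_invariant:
  "(regular_state n (line_state D k t) \<or> exit_state (line_state D k t)) \<and>
   wires_before n D (fst (line_state D k t)) k = wire (line_state D k t)"
proof (induction t)
  case 0
  show ?case using k wires_before_start[of "(int k, 1)"] by (auto simp: regular_state_def wire_def)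
next
  case (Suc t)
  let ?s = "line_state D k t"
  show ?case
  proof (cases "regular_state n ?s")
    case True
    note step = line_step_regular[OF D True]
    have "wires_before n D (fst (line_step D ?s)) k = wire (line_step D ?s)"
      by (rule wires_before_next[OF D step(1) _ step(4)]) (use step(3) Suc in auto)
    then show ?thesis using step(2) by simp
  next
    case False
    then show ?thesis using Suc line_step_exit[of ?s D] by auto
  qed
qed

lemma line_position_mono:
  assumes "s < t" "snd (line_position D k t) \<ge> 1"
  shows "swept_before (line_position D k s) (line_position D k t)"
  using assms
proof (induction t)
  case (Suc t)
  have reg: "regular_state n (line_state D k t)"
    using line_state_invariant[of t] Suc.prems(2) line_step_exit[of "line_state D k t" D]
    by (auto simp: line_position_eq exit_state_def)
  have step: "swept_before (line_position D k t) (line_position D k (Suc t))"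
    using line_step_regular(1)[OF D reg] by (simp add: line_position_eq)
  have "snd (line_position D k t) \<ge> 1"
    using reg by (auto simp: line_position_eq regular_state_def split: prod.splits)
  then show ?case using Suc.IH Suc.prems step by (metis less_SucE swept_before_trans)
qed simp

text \<open>A line visits \<open>p\<close> only on one of the two wires that meet there, by the invariant. Conversely, a line
  that misses \<open>p\<close> would pass from a point before \<open>p\<close> to a point after \<open>p\<close>, or leave the diagram before
  \<open>p\<close>, and in both cases its wire is not touched at \<open>p\<close>; it cannot stay before \<open>p\<close> forever, because its
  points advance strictly within a finite diagram.\<close>
lemma line_visits_iff:
  assumes p: "p \<in> positions n"
  shows "(\<exists>t. line_position D k t = p) \<longleftrightarrow> wires_before n D p k \<in> {letter p, Suc (letter p)}"
proof
  assume "\<exists>t. line_position D k t = p"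
  then obtain t h where t: "line_state D k t = (p, h)" by (metis line_position_eq prod.collapse)
  show "wires_before n D p k \<in> {letter p, Suc (letter p)}"
    using line_state_invariant[of t] p by (auto simp: t wire_def letter_def positions_def split: if_splits)
next
  assume w: "wires_before n D p k \<in> {letter p, Suc (letter p)}"
  show "\<exists>t. line_position D k t = p"
  proof (rule ccontr)
    assume never: "\<nexists>t. line_position D k t = p"
    have before: "swept_before (line_position D k t) p \<and> regular_state n (line_state D k t)" for t
    proof (induction t)
      case 0
      have "\<not> swept_before p (int k, 1)"
      proof
        assume b: "swept_before p (int k, 1)"
        have "wires_before n D p k = k"
          by (rule wires_before_start) (use b in \<open>auto intro: swept_before_trans\<close>)
        then show False using w letter_before_start[OF p b] by auto
      qed
      moreover have "(int k, 1) \<noteq> p" using never[unfolded not_ex, rule_format, of 0] by (simp add: line_position_eq)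
      ultimately show ?case
        using swept_before_total[of "(int k, 1)" p] k by (auto simp: line_position_eq regular_state_def)
    next
      case (Suc t)
      let ?s = "line_state D k t"
      note step = line_step_regular[OF D conjunct2[OF Suc]]
      have inv: "wires_before n D (fst ?s) k = wire ?s" using line_state_invariant by blast
      have not_after: "\<not> swept_before p (fst (line_step D ?s))"
      proof
        assume b: "swept_before p (fst (line_step D ?s))"
        have sp: "swept_before (fst ?s) p" using Suc by (simp add: line_position_eq)
        have "wires_before n D p k = wire (line_step D ?s)"
        proof (rule wires_before_next[OF D sp])
          show "wire (line_step D ?s) = (if fst ?s \<in> D then simple_refl (letter (fst ?s)) (wires_before n D (fst ?s) k)
              else wires_before n D (fst ?s) k)"
            using step(3) inv by simp
          fix r assume "r \<in> positions n" "swept_before (fst ?s) r" "swept_before r p"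
          then show "wire (line_step D ?s) \<noteq> letter r \<and> wire (line_step D ?s) \<noteq> Suc (letter r)"
            using step(4)[of r] swept_before_trans[OF _ b] by blast
        qed
        then show False using step(4)[OF p sp b] w by auto
      qed
      have b: "swept_before (fst (line_step D ?s)) p"
        using not_after swept_before_total[of p "fst (line_step D ?s)"]
          never[unfolded not_ex, rule_format, of "Suc t"] by (auto simp: line_position_eq)
      have "\<not> exit_state (line_step D ?s)"
      proof
        assume ex: "exit_state (line_step D ?s)"
        obtain i j h where s': "line_step D ?s = ((i, j), h)" by (metis prod.exhaust)
        have ij: "i < 0" "j = 0" "h = Across" using ex s' by (auto simp: exit_state_def)
        have above: "wire (line_step D ?s) < letter r"
          if "r \<in> positions n" "swept_before (fst (line_step D ?s)) r" for r
          using that ij by (auto simp: s' wire_def letter_def swept_before_def positions_def split: if_splits)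
        have "fst (line_step D ?s) \<notin> D" using ij D by (auto simp: s' positions_def)
        moreover have "wires_before n D (fst (line_step D ?s)) k = wire (line_step D ?s)"
          using line_state_invariant[of "Suc t"] by simp
        ultimately have "wires_before n D p k = wire (line_step D ?s)"
          by (intro wires_before_next[OF D b]) (simp, metis above not_less_iff_gr_or_eq less_SucI)
        then show False using above[OF p b] w by auto
      qed
      then show ?case using b step(2) by (auto simp: line_position_eq)
    qed
    have reg: "line_position D k t \<in> positions (Suc n)" for t
      using conjunct2[OF before[of t]]
      by (auto simp: line_position_eq regular_state_def positions_def split: prod.splits)
    have "inj (line_position D k)"
    proof (rule injI)
      fix s t assume eq: "line_position D k s = line_position D k t"
      have "snd (line_position D k t) \<ge> 1" for t using reg[of t] by (auto simp: positions_def)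
      then show "s = t" using line_position_mono eq swept_before_irrefl by (metis nat_neq_iff)
    qed
    then have "infinite (range (line_position D k))" by (simp add: finite_image_iff)
    moreover have "range (line_position D k) \<subseteq> positions (Suc n)" using reg by blast
    ultimately show False using finite_positions finite_subset by blast
  qed
qed

lemma precedes_on_line_iff:
  assumes p: "p \<in> positions n" and q: "q \<in> positions n"
  shows "precedes_on_line D k p q \<longleftrightarrow> swept_before p q \<and>
    wires_before n D p k \<in> {letter p, Suc (letter p)} \<and> wires_before n D q k \<in> {letter q, Suc (letter q)}"
    (is "_ \<longleftrightarrow> _ \<and> ?V p \<and> ?V q")
proof
  assume "precedes_on_line D k p q"
  then obtain s t where st: "s < t" "line_position D k s = p" "line_position D k t = q"
    by (auto simp: precedes_on_line_def)
  moreover have "snd q \<ge> 1" using q by (auto simp: positions_def)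
  ultimately show "swept_before p q \<and> ?V p \<and> ?V q"
    using line_position_mono[of s t] line_visits_iff[OF p] line_visits_iff[OF q] by blast
next
  assume a: "swept_before p q \<and> ?V p \<and> ?V q"
  then obtain s t where st: "line_position D k s = p" "line_position D k t = q"
    using line_visits_iff[OF p] line_visits_iff[OF q] by blast
  have "s < t"
  proof (rule ccontr)
    assume "\<not> s < t"
    then consider "t < s" | "s = t" by linarith
    then show False
    proof cases
      case 1
      have "snd p \<ge> 1" using p by (auto simp: positions_def)
      then have "swept_before q p" using line_position_mono[OF 1] st by simp
      then show False using a swept_before_trans swept_before_irrefl by blast
    next
      case 2 then show False using a st swept_before_irrefl by auto
    qed
  qed
  then show "precedes_on_line D k p q" using st by (auto simp: precedes_on_line_def)
qed

end

section \<open>Absorbable positions\<close>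

lemma wires_before_split:
  assumes "reading n = qs @ p # rs"
  shows "wires_before n D p = word_perm (subword letter D rs)"
proof -
  have "sorted_wrt (\<lambda>p q. swept_before q p) (qs @ p # rs)" using sorted_reading[of n] assms by simp
  then have "\<forall>q\<in>set qs. swept_before p q" "\<forall>r\<in>set rs. swept_before r p"
    by (auto simp: sorted_wrt_append)
  then have "filter (\<lambda>q. swept_before q p) qs = []" "filter (\<lambda>q. swept_before q p) rs = rs"
    unfolding filter_empty_conv filter_id_conv using swept_before_irrefl swept_before_trans by blast+
  then show ?thesis unfolding wires_before_def assms using swept_before_irrefl by simp
qed

lemma subword_split:
  "subword f D ps = bs @ b # cs \<longleftrightarrow>
   (\<exists>qs q rs. ps = qs @ q # rs \<and> q \<in> D \<and> bs = subword f D qs \<and> b = f q \<and> cs = subword f D rs)"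
proof
  assume "subword f D ps = bs @ b # cs"
  then show "\<exists>qs q rs. ps = qs @ q # rs \<and> q \<in> D \<and> bs = subword f D qs \<and> b = f q \<and> cs = subword f D rs"
  proof (induction ps arbitrary: bs)
    case (Cons p ps)
    show ?case
    proof (cases "p \<in> D \<and> bs = []")
      case True
      then show ?thesis using Cons.prems by (intro exI[of _ "[]"]) auto
    next
      case False
      define bs' where "bs' = (if p \<in> D then tl bs else bs)"
      have bs: "bs = (if p \<in> D then f p # bs' else bs')" "subword f D ps = bs' @ b # cs"
        using Cons.prems False unfolding bs'_def by (cases bs; auto)+
      from Cons.IH[OF bs(2)] obtain qs q rs where "ps = qs @ q # rs" "q \<in> D" "bs' = subword f D qs"
        "b = f q" "cs = subword f D rs" by blast
      then show ?thesis using bs(1) by (intro exI[of _ "p # qs"]) auto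
    qed
  qed simp
qed auto

lemma crossing_exists_iff:
  "(\<exists>bs b cs. subword f D ps = bs @ b # cs \<and> {word_perm cs c, word_perm cs d} = {b, Suc b}) \<longleftrightarrow>
   (\<exists>qs q rs. ps = qs @ q # rs \<and> q \<in> D \<and>
      {word_perm (subword f D rs) c, word_perm (subword f D rs) d} = {f q, Suc (f q)})"
  unfolding subword_split by blast

lemma subword_letters: "set ps \<subseteq> positions n \<Longrightarrow> set (subword letter D ps) \<subseteq> {1..<n}"
  using letter_positions by (fastforce simp: subword_def)

text \<open>The two lines on the wires \<open>b\<close> and \<open>b + 1\<close> of \<open>z\<close> are \<open>z\<^sup>-\<^sup>1(b)\<close> and \<open>z\<^sup>-\<^sup>1(b + 1)\<close>.\<close>
lemma two_lines_iff:
  fixes z z' :: "nat \<Rightarrow> nat"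
  assumes z: "z permutes {1..n}" and b: "b \<in> {1..<n}" and inj: "inj z'"
    and Q: "\<And>k. k \<in> {1..n} \<Longrightarrow> Q k \<longleftrightarrow> C \<and> z k \<in> {b, Suc b} \<and> z' k \<in> {c, Suc c}"
  shows "(\<exists>k\<in>{1..n}. \<exists>l\<in>{1..n}. k \<noteq> l \<and> Q k \<and> Q l) \<longleftrightarrow>
         C \<and> {z' (inv z b), z' (inv z (Suc b))} = {c, Suc c}"
proof
  assume "\<exists>k\<in>{1..n}. \<exists>l\<in>{1..n}. k \<noteq> l \<and> Q k \<and> Q l"
  then obtain k l where kl: "k \<in> {1..n}" "l \<in> {1..n}" "k \<noteq> l" "Q k" "Q l" by blast
  note Qk = Q[OF kl(1)] and Ql = Q[OF kl(2)]
  have "z k \<noteq> z l" "z' k \<noteq> z' l" using kl(3) inj permutes_inj[OF z] by (auto dest: injD)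
  then have "{z k, z l} = {b, Suc b}" "{z' k, z' l} = {c, Suc c}" using kl(4,5) Qk Ql by auto
  moreover have "inv z (z k) = k" "inv z (z l) = l" using permutes_inverses(2)[OF z] by auto
  ultimately show "C \<and> {z' (inv z b), z' (inv z (Suc b))} = {c, Suc c}"
    using kl(4) Qk by (auto simp: doubleton_eq_iff)
next
  assume c: "C \<and> {z' (inv z b), z' (inv z (Suc b))} = {c, Suc c}"
  have k: "inv z b \<in> {1..n}" "inv z (Suc b) \<in> {1..n}"
    using b by (simp_all only: permutes_in_image[OF permutes_inv[OF z]]) auto
  have "inv z b \<noteq> inv z (Suc b)" using permutes_neq_Suc[OF permutes_inv[OF z]] .
  moreover have "z (inv z b) = b" "z (inv z (Suc b)) = Suc b" using permutes_inverses(1)[OF z] by auto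
  then have "Q (inv z b)" "Q (inv z (Suc b))" using c Q[OF k(1)] Q[OF k(2)] by auto
  ultimately show "\<exists>k\<in>{1..n}. \<exists>l\<in>{1..n}. k \<noteq> l \<and> Q k \<and> Q l" using k by blast
qed

lemma wires_before_permutes: "wires_before n D p permutes {1..n}"
  unfolding wires_before_def by (intro word_perm_permutes subword_letters) (auto simp: set_reading)

text \<open>The lines that avoid each other at \<open>p\<close> enter the part of the diagram after \<open>p\<close>, whose word is the
  part of the reading on the left of \<open>p\<close>, on the wires \<open>a\<close> and \<open>a + 1\<close>. They cross there exactly if the
  product of that part inverts \<open>a\<close> and \<open>a + 1\<close>.\<close>
lemma rabs_eq_absorbed:
  assumes D: "D \<subseteq> positions n" and asc: "ascending id (subword letter D (reading n))"
  shows "rabs n D = absorbed letter id (reading n) D"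
proof (rule set_eqI)
  fix p
  show "p \<in> rabs n D \<longleftrightarrow> p \<in> absorbed letter id (reading n) D"
  proof (cases "p \<in> positions n - D")
    case False
    then show ?thesis using absorbed_subset[of letter id "reading n" D] by (auto simp: rabs_def set_reading)
  next
    case True
    then obtain qs rs where split: "reading n = qs @ p # rs"
      by (metis Diff_iff set_reading split_list)
    have pos: "set qs \<subseteq> positions n" "set rs \<subseteq> positions n" using set_reading[of n] split by auto
    let ?w = "\<lambda>ps. word_perm (subword letter D ps)"
    let ?a = "letter p"
    have a: "?a \<in> {1..<n}" using True letter_positions by blast
    have unique: "qs' = qs" if "reading n = qs' @ p # rs'" for qs' rs'
    proof -
      have "p \<notin> set qs" "p \<notin> set rs" using distinct_reading[of n] split by auto
      then show ?thesis using that split by (metis append_Cons_eq_iff)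
    qed
    have "p \<in> absorbed letter id (reading n) D \<longleftrightarrow> ?w qs (Suc ?a) < ?w qs ?a"
      using True split unique by (auto simp: absorbed_def)
    also have "\<dots> \<longleftrightarrow> (\<exists>qs1 q qs2. qs = qs1 @ q # qs2 \<and> q \<in> D \<and>
        {?w qs2 ?a, ?w qs2 (Suc ?a)} = {letter q, Suc (letter q)})"
      unfolding crossing_exists_iff[symmetric]
      by (rule inversion_iff_crossing[of _ n])
         (use asc subword_letters[OF pos(1)] in \<open>simp_all add: split ascending_append\<close>)
    also have "\<dots> \<longleftrightarrow> (\<exists>q\<in>D. swept_before p q \<and>
        {wires_before n D q (inv (wires_before n D p) ?a), wires_before n D q (inv (wires_before n D p) (Suc ?a))}
          = {letter q, Suc (letter q)})" (is "?L \<longleftrightarrow> ?R")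
    proof -
      have z: "wires_before n D p = ?w rs" using wires_before_split[OF split] .
      have perm: "?w rs permutes {1..n}" using word_perm_permutes[OF subword_letters[OF pos(2)]] .
      have zq: "wires_before n D q (inv (?w rs) c) = ?w qs2 c" if "qs = qs1 @ q # qs2" for qs1 q qs2 c
      proof -
        have "wires_before n D q = ?w (qs2 @ p # rs)" by (rule wires_before_split[of n qs1]) (simp add: split that)
        also have "\<dots> = ?w qs2 \<circ> ?w rs" using True by (simp add: word_perm_append)
        finally show ?thesis using permutes_inverses(1)[OF perm] by simp
      qed
      have sorted: "sorted_wrt (\<lambda>p q. swept_before q p) (qs @ p # rs)" using sorted_reading[of n] split by simp
      show ?thesis
      proof
        assume ?L
        then obtain qs1 q qs2 where q: "qs = qs1 @ q # qs2" "q \<in> D"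
          "{?w qs2 ?a, ?w qs2 (Suc ?a)} = {letter q, Suc (letter q)}" by blast
        then have "swept_before p q" using sorted by (simp add: sorted_wrt_append)
        then show ?R unfolding z using q(2,3)
          by (intro bexI[of _ q] conjI) (simp_all only: zq[OF q(1)])
      next
        assume ?R
        then obtain q where q: "q \<in> D" "swept_before p q"
          "{wires_before n D q (inv (?w rs) ?a), wires_before n D q (inv (?w rs) (Suc ?a))} = {letter q, Suc (letter q)}"
          unfolding z by blast
        have "q \<in> set (qs @ p # rs)" using q(1) D split set_reading[of n] by auto
        moreover have "\<forall>r\<in>set rs. swept_before r p" using sorted by (simp add: sorted_wrt_append)
        then have "q \<notin> set rs" "q \<noteq> p"
          using q(2) swept_before_irrefl swept_before_trans by blast+
        ultimately have "q \<in> set qs" by auto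
        then obtain qs1 qs2 where "qs = qs1 @ q # qs2" by (metis split_list)
        then show ?L using q zq by metis
      qed
    qed
    also have "\<dots> \<longleftrightarrow> p \<in> rabs n D"
    proof -
      have "(\<exists>k\<in>{1..n}. \<exists>l\<in>{1..n}. k \<noteq> l \<and> precedes_on_line D k p q \<and> precedes_on_line D l p q) \<longleftrightarrow>
          swept_before p q \<and> {wires_before n D q (inv (wires_before n D p) ?a),
            wires_before n D q (inv (wires_before n D p) (Suc ?a))} = {letter q, Suc (letter q)}"
        if "q \<in> D" for q
        by (rule two_lines_iff[OF wires_before_permutes a permutes_inj[OF wires_before_permutes]])
           (use True D that precedes_on_line_iff[OF D] in blast)
      then show ?thesis unfolding rabs_def mem_Collect_eq using True by (simp cong: bex_cong del: One_nat_def)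
    qed
    finally show ?thesis by blast
  qed
qed

text \<open>The part of the diagram before \<open>p\<close> has as its word the part of the reading on the right of \<open>p\<close>, with
  product \<open>z\<close>. The lines \<open>z\<^sup>-\<^sup>1(a)\<close> and \<open>z\<^sup>-\<^sup>1(a + 1)\<close> that avoid each other at \<open>p\<close> have crossed in it
  exactly if \<open>z\<close> inverts them, that is, if \<open>z\<^sup>-\<^sup>1\<close> has a descent at \<open>a\<close>; and \<open>z\<^sup>-\<^sup>1\<close> is the product of
  the letters on the left of \<open>p\<close> in the reversed reading.\<close>
lemma labs_eq_absorbed:
  assumes D: "D \<subseteq> positions n" and asc: "ascending id (subword letter D (reading n))"
  shows "labs n D = absorbed letter id (rev (reading n)) D"
proof (rule set_eqI)
  fix p
  show "p \<in> labs n D \<longleftrightarrow> p \<in> absorbed letter id (rev (reading n)) D"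
  proof (cases "p \<in> positions n - D")
    case False
    then show ?thesis using absorbed_subset[of letter id "rev (reading n)" D] by (auto simp: labs_def set_reading)
  next
    case True
    then obtain qs rs where split: "reading n = qs @ p # rs"
      by (metis Diff_iff set_reading split_list)
    have pos: "set qs \<subseteq> positions n" "set rs \<subseteq> positions n" using set_reading[of n] split by auto
    let ?w = "\<lambda>ps. word_perm (subword letter D ps)"
    let ?a = "letter p"
    let ?z = "wires_before n D p"
    have a: "?a \<in> {1..<n}" using True letter_positions by blast
    have z: "?z = ?w rs" using wires_before_split[OF split] .
    have zz: "?z (inv ?z c) = c" for c using permutes_inverses(1)[OF wires_before_permutes] .
    have unique: "qs' = rev rs" if "rev (reading n) = qs' @ p # rs'" for qs' rs'
    proof -
      have "p \<notin> set qs" "p \<notin> set rs" using distinct_reading[of n] split by auto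
      then show ?thesis using that split by (auto simp: append_Cons_eq_iff)
    qed
    moreover have "rev (reading n) = rev rs @ p # rev qs" using split by simp
    ultimately have prefix: "(\<exists>qs' rs'. rev (reading n) = qs' @ p # rs' \<and> P qs') \<longleftrightarrow> P (rev rs)" for P
      by metis
    have asc_rs: "ascending id (subword letter D rs)"
    proof -
      have "ascending id (rev (subword letter D (reading n)))"
        using ascending_rev[of "subword letter D (reading n)" n] asc subword_letters[of "reading n"]
        by (simp add: set_reading)
      then show ?thesis
        using ascending_rev[OF subword_letters[OF pos(2)]] True by (simp add: split ascending_append)
    qed
    have "p \<in> absorbed letter id (rev (reading n)) D \<longleftrightarrow> ?w (rev rs) (Suc ?a) < ?w (rev rs) ?a"
      unfolding absorbed_def mem_Collect_eq prefix using True by simp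
    also have "?w (rev rs) = inv ?z"
      unfolding z using word_perm_rev[OF subword_letters[OF pos(2)]] by simp
    also have "inv ?z (Suc ?a) < inv ?z ?a \<longleftrightarrow> (\<exists>rs1 q rs2. rs = rs1 @ q # rs2 \<and> q \<in> D \<and>
        {?w rs2 (inv ?z ?a), ?w rs2 (inv ?z (Suc ?a))} = {letter q, Suc (letter q)})"
      (is "?less \<longleftrightarrow> ?crosses")
    proof -
      have crossing: "?w rs d < ?w rs c \<longleftrightarrow> (\<exists>rs1 q rs2. rs = rs1 @ q # rs2 \<and> q \<in> D \<and>
        {?w rs2 c, ?w rs2 d} = {letter q, Suc (letter q)})" if "c < d" for c d
        unfolding crossing_exists_iff[symmetric]
        by (rule inversion_iff_crossing[OF subword_letters[OF pos(2)] asc_rs that])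
      have "inv ?z (Suc ?a) < inv ?z ?a \<or> inv ?z ?a < inv ?z (Suc ?a)"
        using permutes_neq_Suc[OF permutes_inv[OF wires_before_permutes[of n D p]], of ?a] by (meson nat_neq_iff)
      then show ?thesis
      proof
        assume less: "inv ?z (Suc ?a) < inv ?z ?a"
        have "?w rs (inv ?z ?a) < ?w rs (inv ?z (Suc ?a))" using zz z by simp
        then show ?thesis using less unfolding crossing[OF less] by (simp add: insert_commute)
      next
        assume less: "inv ?z ?a < inv ?z (Suc ?a)"
        have "\<not> ?w rs (inv ?z (Suc ?a)) < ?w rs (inv ?z ?a)" using zz z by simp
        then show ?thesis using less unfolding crossing[OF less] by simp
      qed
    qed
    also have "\<dots> \<longleftrightarrow> (\<exists>q\<in>D. swept_before q p \<and>
        {wires_before n D q (inv ?z ?a), wires_before n D q (inv ?z (Suc ?a))} = {letter q, Suc (letter q)})"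
      (is "?L \<longleftrightarrow> ?R")
    proof -
      have zq: "wires_before n D q = ?w rs2" if "rs = rs1 @ q # rs2" for rs1 q rs2
        by (rule wires_before_split[of n "qs @ p # rs1"]) (simp add: split that)
      have sorted: "sorted_wrt (\<lambda>p q. swept_before q p) (qs @ p # rs)" using sorted_reading[of n] split by simp
      show ?thesis
      proof
        assume ?L
        then obtain rs1 q rs2 where q: "rs = rs1 @ q # rs2" "q \<in> D"
          "{?w rs2 (inv ?z ?a), ?w rs2 (inv ?z (Suc ?a))} = {letter q, Suc (letter q)}" by blast
        then have "swept_before q p" using sorted by (simp add: sorted_wrt_append)
        then show ?R using q(2,3) by (intro bexI[of _ q] conjI) (simp_all only: zq[OF q(1)])
      next
        assume ?R
        then obtain q where q: "q \<in> D" "swept_before q p"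
          "{wires_before n D q (inv ?z ?a), wires_before n D q (inv ?z (Suc ?a))} = {letter q, Suc (letter q)}"
          by blast
        have "q \<in> set (qs @ p # rs)" using q(1) D split set_reading[of n] by auto
        moreover have "\<forall>r\<in>set qs. swept_before p r" using sorted by (simp add: sorted_wrt_append)
        then have "q \<notin> set qs" "q \<noteq> p"
          using q(2) swept_before_irrefl swept_before_trans by blast+
        ultimately have "q \<in> set rs" by auto
        then obtain rs1 rs2 where "rs = rs1 @ q # rs2" by (metis split_list)
        then show ?L using q zq by metis
      qed
    qed
    also have "\<dots> \<longleftrightarrow> p \<in> labs n D"
    proof -
      have "(\<exists>k\<in>{1..n}. \<exists>l\<in>{1..n}. k \<noteq> l \<and> precedes_on_line D k q p \<and> precedes_on_line D l q p) \<longleftrightarrow>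
          swept_before q p \<and> {wires_before n D q (inv ?z ?a), wires_before n D q (inv ?z (Suc ?a))}
            = {letter q, Suc (letter q)}"
        if "q \<in> D" for q
        by (rule two_lines_iff[OF wires_before_permutes a permutes_inj[OF wires_before_permutes]])
           (use True D that precedes_on_line_iff[OF D] in blast)
      then show ?thesis unfolding labs_def mem_Collect_eq using True by (simp cong: bex_cong del: One_nat_def)
    qed
    finally show ?thesis by blast
  qed
qed

section \<open>The two formulas\<close>

lemma word_perm_reading_permutes: "word_perm (subword letter D (reading n)) permutes {1..n}"
  by (intro word_perm_permutes subword_letters) (simp add: set_reading)

lemma letters_reading: "letter ` set (reading n) \<subseteq> {1..<n}"
  using letter_positions by (auto simp: set_reading)

lemma ascending_subsets_rev:
  assumes "w permutes {1..n}"
  shows "ascending_subsets letter id (rev (reading n)) (inv w) = ascending_subsets letter id (reading n) w"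
proof -
  have "ascending id (subword letter D (rev (reading n))) \<longleftrightarrow> ascending id (subword letter D (reading n))"
    "word_perm (subword letter D (rev (reading n))) = inv (word_perm (subword letter D (reading n)))" for D
    using ascending_rev[OF subword_letters[of "reading n" n D]] word_perm_rev[OF subword_letters[of "reading n" n D]]
    by (simp_all add: set_reading)
  moreover have "inv u = inv w \<longleftrightarrow> u = w" if "u permutes {1..n}" for u
    using permutes_inv_inv[OF that] permutes_inv_inv[OF assms] by metis
  ultimately show ?thesis
    by (simp add: ascending_subsets_def word_perm_reading_permutes del: One_nat_def)
qed

theorem corollary6p18:
  fixes n :: nat and w :: "nat \<Rightarrow> nat"
  assumes "w permutes {1..n}"
  shows "double_H n w = (\<Sum>D\<in>double_rc_graphs n w.
           (\<Prod>(i, j)\<in>D. Var i) * (\<Prod>(i, j)\<in>positions n - (D \<union> rabs n D). 1 - Var i)) \<and>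
         double_H n w = (\<Sum>D\<in>double_rc_graphs n w.
           (\<Prod>(i, j)\<in>D. Var i) * (\<Prod>(i, j)\<in>positions n - (D \<union> labs n D). 1 - Var i))"
proof -
  let ?x = "\<lambda>p::int \<times> nat. Var (fst p)"
  let ?A = "ascending_subsets letter id (reading n) w"
  have prods: "(\<Prod>(i, j)\<in>B. Var i) = prod ?x B" "(\<Prod>(i, j)\<in>B. 1 - Var i) = (\<Prod>p\<in>B. 1 - ?x p)"
    for B :: "(int \<times> nat) set"
    by (simp_all add: case_prod_unfold)
  have D: "D \<subseteq> positions n" "ascending id (subword letter D (reading n))" if "D \<in> ?A" for D
    using that by (auto simp: ascending_subsets_def set_reading)
  have H: "double_H n w = coeff_at (map (\<lambda>p. hecke (letter p) (?x p)) (reading n)) w"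
    unfolding double_H_eq_coeff[OF assms] double_word_eq ..
  also have "\<dots> = (\<Sum>D\<in>?A. prod ?x D * (\<Prod>p\<in>set (reading n) - (D \<union> absorbed letter id (reading n) D). 1 - ?x p))"
    unfolding coeff_at_def by (rule act_delta_subwords[OF distinct_reading letters_reading permutes_id])
  also have "\<dots> = (\<Sum>D\<in>?A. prod ?x D * (\<Prod>p\<in>positions n - (D \<union> rabs n D). 1 - ?x p))"
    by (rule sum.cong) (simp_all add: rabs_eq_absorbed[OF D] set_reading)
  finally have right: "double_H n w = \<dots>" .
  have "double_H n w = coeff_at (map (\<lambda>p. hecke (letter p) (?x p)) (rev (reading n))) (inv w)"
    unfolding H rev_map[symmetric]
    by (rule coeff_at_rev[symmetric, of _ n, OF _ assms]) (simp only: set_map image_image fst_conv letters_reading)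
  also have "\<dots> = (\<Sum>D\<in>ascending_subsets letter id (rev (reading n)) (inv w).
      prod ?x D * (\<Prod>p\<in>set (rev (reading n)) - (D \<union> absorbed letter id (rev (reading n)) D). 1 - ?x p))"
    unfolding coeff_at_def
    by (rule act_delta_subwords[where n = n]) (simp_all only: distinct_rev distinct_reading set_rev letters_reading permutes_id)
  also have "\<dots> = (\<Sum>D\<in>?A. prod ?x D * (\<Prod>p\<in>positions n - (D \<union> labs n D). 1 - ?x p))"
    unfolding ascending_subsets_rev[OF assms]
    by (rule sum.cong) (simp_all add: labs_eq_absorbed[OF D] set_reading)
  finally have left: "double_H n w = \<dots>" .
  show ?thesis unfolding prods double_rc_graphs_eq using right left by blast
qed

end
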